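(* Let $u_0 \in L^2(\mathbb{R})$ be complex-valued with $x u_0 \in L^2(\mathbb{R})$, and let $u(t,x)$ be the solution of the free Schrödinger equation $i\,\partial_t u = -\frac12 \partial_x^2 u$ with initial data $u(0,x)=u_0(x)$, given by $$u(t,x) = (2\pi)^{-\frac12}\int_{-\infty}^{\infty} e^{ix\xi} e^{-\frac12 i t \xi^2}\,\hat u_0(\xi)\,d\xi .$$ If $$\xi^{-2}\hat u_0(\xi) \in L^2(|\xi|<1) \quad\text{and}\quad \xi^{-1}\left(\frac{\partial}{\partial \xi}\hat u_0\right)(\xi) \in L^2(|\xi|<1),$$ then there is a constant $C>0$, independent of both $t$ and $x$, such that $$|u(t,x)| \le C\,(1+|x|)\,|t|^{-1}$$ for all $t \in \mathbb{R}\setminus\{0\}$ and all $x\in\mathbb{R}$.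
   Context: For $v \in L^2(\mathbb{R})$, $\hat v(\xi) = (2\pi)^{-\frac12}\int_{-\infty}^{\infty} e^{-ix\xi} v(x)\,dx$ denotes the Fourier transform (in the usual Plancherel sense on $L^2(\mathbb{R})$). $L^2(|\xi|<1)$ is the space of square-integrable complex-valued functions on the open interval $(-1,1)$. Since $x u_0 \in L^2(\mathbb{R})$, $\hat u_0$ has a weak derivative $\frac{\partial}{\partial\xi}\hat u_0 \in L^2(\mathbb{R})$. The function $\hat u_0$ need not be Lebesgue integrable on $\mathbb{R}$; for $t \ne 0$ the integral defining $u(t,x)$ is understood as the improper integral $\lim_{R\to\infty}\int_{-R}^{R}$. The constant $C$ may depend on $u_0$. *)

theory Defs
  imports "HOL-Analysis.Analysis"
begin

definition square_integrable_on :: "(real \<Rightarrow> complex) \<Rightarrow> real set \<Rightarrow> bool"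
    (infixr "square'_integrable'_on" 46) where
  "f square_integrable_on S \<longleftrightarrow>
     set_borel_measurable lebesgue S f \<and>
     set_integrable lebesgue S (\<lambda>x. (cmod (f x))\<^sup>2)"

definition truncated_fourier :: "real \<Rightarrow> (real \<Rightarrow> complex) \<Rightarrow> real \<Rightarrow> complex" where
  "truncated_fourier R v \<xi> =
     complex_of_real ((2 * pi) powr (-1/2)) *
     (LINT x:{-R..R}|lebesgue. exp (- (\<i> * of_real (x * \<xi>))) * v x)"

text \<open>
  Plancherel's Fourier transform: the limit in mean square of the truncated transforms.
  The squared distance is a nonnegative (extended) integral because the Bochner integral
  of a nonintegrable function is 0.
\<close>

definition has_L2_fourier_transform ::
    "(real \<Rightarrow> complex) \<Rightarrow> (real \<Rightarrow> complex) \<Rightarrow> bool"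
    (infixr "has'_L2'_fourier'_transform" 46) where
  "v has_L2_fourier_transform w \<longleftrightarrow>
     w square_integrable_on UNIV \<and>
     ((\<lambda>R. \<integral>\<^sup>+ \<xi>. ennreal ((cmod (truncated_fourier R v \<xi> - w \<xi>))\<^sup>2) \<partial>lebesgue)
        \<longlongrightarrow> 0) at_top"

text \<open>
  By Plancherel's theorem this exists for every square-integrable \<open>v\<close>; it is determined
  up to a null set, and the choice selects a representative.
\<close>

definition L2_fourier :: "(real \<Rightarrow> complex) \<Rightarrow> real \<Rightarrow> complex" where
  "L2_fourier v = (SOME w. v has_L2_fourier_transform w)"

definition test_function :: "(real \<Rightarrow> real) \<Rightarrow> bool" where
  "test_function \<phi> \<longleftrightarrow>
     (\<forall>n x. (deriv ^^ n) \<phi> differentiable at x) \<and> compact (closure {x. \<phi> x \<noteq> 0})"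

definition locally_integrable :: "(real \<Rightarrow> complex) \<Rightarrow> bool" where
  "locally_integrable f \<longleftrightarrow> (\<forall>K. compact K \<longrightarrow> set_integrable lebesgue K f)"

text \<open>Real-valued test functions suffice: both sides below are complex linear in \<open>\<phi>\<close>.\<close>

definition has_weak_derivative ::
    "(real \<Rightarrow> complex) \<Rightarrow> (real \<Rightarrow> complex) \<Rightarrow> bool"
    (infixr "has'_weak'_derivative" 46) where
  "f has_weak_derivative g \<longleftrightarrow>
     locally_integrable f \<and> locally_integrable g \<and>
     (\<forall>\<phi>. test_function \<phi> \<longrightarrow>
        (LINT \<xi>|lebesgue. deriv \<phi> \<xi> *\<^sub>R f \<xi>) = - (LINT \<xi>|lebesgue. \<phi> \<xi> *\<^sub>R g \<xi>))"

text \<open>Again unique up to a null set, so a representative is chosen.\<close>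

definition weak_deriv :: "(real \<Rightarrow> complex) \<Rightarrow> real \<Rightarrow> complex" where
  "weak_deriv f = (SOME g. f has_weak_derivative g)"

definition truncated_schroedinger ::
    "(real \<Rightarrow> complex) \<Rightarrow> real \<Rightarrow> real \<Rightarrow> real \<Rightarrow> complex" where
  "truncated_schroedinger u0 t x R =
     complex_of_real ((2 * pi) powr (-1/2)) *
     (LINT \<xi>:{-R..R}|lebesgue.
        exp (\<i> * of_real (x * \<xi>)) * exp (- (\<i> * of_real (t * \<xi>\<^sup>2 / 2))) * L2_fourier u0 \<xi>)"

text \<open>
  The solution of \<open>\<i> \<partial>\<^sub>t u = - (1/2) \<partial>\<^sub>x\<^sup>2 u\<close>, \<open>u(0, x) = u0 x\<close>; for \<open>t \<noteq> 0\<close> it is the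
  improper integral over the frequency line.
\<close>

definition free_schroedinger ::
    "(real \<Rightarrow> complex) \<Rightarrow> real \<Rightarrow> real \<Rightarrow> complex" where
  "free_schroedinger u0 t x =
     (if t = 0 then u0 x else Lim at_top (truncated_schroedinger u0 t x))"

end

theory Submission
  imports Defs "HOL-Probability.Characteristic_Functions" "HOL-Probability.Sinc_Integral"
begin

text \<open>
  Since \<open>u0\<close> and \<open>x u0\<close> are square integrable, \<open>u0\<close> is integrable, and its transform agrees
  almost everywhere with a bounded continuous function \<open>F\<close> that is an indefinite integral of some
  \<open>h\<close>, square integrable away from the origin. Outside the origin the phase
  \<open>e \<xi> = exp (\<i> x \<xi> - \<i> t \<xi>\<^sup>2 / 2)\<close> satisfies \<open>e = (\<i> / (t \<xi>)) (e' - \<i> x e)\<close>, so integration by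
  parts turns \<open>\<integral> e F\<close> into \<open>1 / t\<close> times an integral of \<open>e\<close> against \<open>x F / \<xi>\<close>, \<open>F / \<xi>\<^sup>2\<close> and
  \<open>h / \<xi>\<close>. These are integrable: near the origin by hypothesis, away from it as products of two
  square integrable functions. The boundary terms at infinity vanish since \<open>F\<close> is bounded.
  At the origin, integrability of \<open>F / \<xi>\<^sup>2\<close> forces \<open>F 0 = 0\<close>, whence
  \<open>\<bar>F \<epsilon> / \<epsilon>\<bar> \<le> \<integral>\<^sub>0\<^sup>\<epsilon> \<bar>h / \<xi>\<bar> \<longrightarrow> 0\<close>.
\<close>

subsection \<open>Fourier transform and Plancherel inequality\<close>

text \<open>One power of \<open>1 / t\<close> costs one derivative of the transform, and
  \<open>x * u0\<close> need not be integrable, so this derivative cannot be written as an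
  absolutely convergent integral; it arises as a mean-square limit. Hence the Plancherel inequality,
  obtained by Gaussian regularisation, and the completeness argument. No pointwise derivative of
  \<open>F\<close> is ever taken: its increments are integrals, and integration by parts against it
  is Fubini on a triangle.

  The second obstacle is that \<open>L2_fourier\<close> and \<open>weak_deriv\<close> are
  unspecified representatives. The hypotheses near the origin speak of these, whereas square
  integrability on the whole line is known for \<open>F\<close> and for the mean-square limit
  \<open>G\<close>. The transforms are compared almost everywhere, the derivatives through their
  integrals over intervals, by testing with smooth cutoffs. Such integrals do not change when
  \<open>h\<close> is patched together from the chosen derivative near the origin and
  \<open>G\<close> elsewhere.\<close>

lemma integrable_kernel_pair:
  fixes A B :: "real \<Rightarrow> complex" and K :: "real \<Rightarrow> real \<Rightarrow> complex"
  assumes A: "integrable lborel A" and B: "integrable lborel B"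
    and K: "case_prod K \<in> borel_measurable (lborel \<Otimes>\<^sub>M lborel)"
    and le: "\<And>x y. cmod (K x y) \<le> 1"
  shows "integrable (lborel \<Otimes>\<^sub>M lborel) (\<lambda>(x, y). A x * B y * K x y)"
proof -
  note [measurable] = borel_measurable_integrable[OF A] borel_measurable_integrable[OF B] K
  have "integrable (lborel \<Otimes>\<^sub>M lborel) (\<lambda>(x, y). A x * B y)"
  proof (rule lborel_pair.Fubini_integrable)
    have "(\<lambda>x. \<integral>y. cmod (A x * B y) \<partial>lborel) = (\<lambda>x. cmod (A x) * (\<integral>y. cmod (B y) \<partial>lborel))"
      by (simp add: norm_mult)
    then show "integrable lborel (\<lambda>x. \<integral>y. norm (case (x, y) of (x, y) \<Rightarrow> A x * B y) \<partial>lborel)"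
      using A by simp
  qed (use B in auto)
  then show ?thesis
  proof (rule Bochner_Integration.integrable_bound)
    show "(\<lambda>(x, y). A x * B y * K x y) \<in> borel_measurable (lborel \<Otimes>\<^sub>M lborel)"
      by measurable
    show "AE z in lborel \<Otimes>\<^sub>M lborel.
        norm (case z of (x, y) \<Rightarrow> A x * B y * K x y) \<le> norm (case z of (x, y) \<Rightarrow> A x * B y)"
    proof (intro AE_I2)
      fix z :: "real \<times> real"
      have "norm (A (fst z) * B (snd z) * K (fst z) (snd z)) \<le> norm (A (fst z) * B (snd z)) * 1"
        unfolding norm_mult[of _ "K _ _"] by (intro mult_left_mono le) simp
      then show "norm (case z of (x, y) \<Rightarrow> A x * B y * K x y) \<le> norm (case z of (x, y) \<Rightarrow> A x * B y)"
        by (simp add: split_beta)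
    qed
  qed
qed

text \<open>Every interchange of Bochner integrals below has this shape: two integrable factors in
  separate variables, coupled by a bounded kernel. The kernel is a character in the Fourier
  arguments and the indicator of a half-plane in integration by parts.\<close>

lemma integral_kernel_swap:
  fixes A B :: "real \<Rightarrow> complex" and K :: "real \<Rightarrow> real \<Rightarrow> complex"
  assumes "integrable lborel A" and "integrable lborel B"
    and "case_prod K \<in> borel_measurable (lborel \<Otimes>\<^sub>M lborel)"
    and "\<And>x y. cmod (K x y) \<le> 1"
  shows "(\<integral>x. A x * (\<integral>y. B y * K x y \<partial>lborel) \<partial>lborel) =
         (\<integral>y. B y * (\<integral>x. A x * K x y \<partial>lborel) \<partial>lborel)"
proof -
  have "(\<integral>y. (\<integral>x. A x * B y * K x y \<partial>lborel) \<partial>lborel) = (\<integral>x. (\<integral>y. A x * B y * K x y \<partial>lborel) \<partial>lborel)"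
    using lborel_pair.Fubini_integral[OF integrable_kernel_pair[OF assms]] .
  moreover have "(\<integral>x. A x * B y * K x y \<partial>lborel) = B y * (\<integral>x. A x * K x y \<partial>lborel)" for y
    by (simp flip: integral_mult_right_zero add: mult.assoc mult.left_commute)
  moreover have "(\<integral>y. A x * B y * K x y \<partial>lborel) = A x * (\<integral>y. B y * K x y \<partial>lborel)" for x
    by (simp flip: integral_mult_right_zero add: mult.assoc mult.left_commute)
  ultimately show ?thesis by simp
qed

text \<open>This is the characteristic function of the standard normal law at
  \<open>s / \<delta>\<close>, rescaled by \<open>y = \<delta> * \<xi>\<close>. Writing the value as
  a multiple of a normal density of width \<open>\<delta>\<close> shows its total mass
  \<open>2 * pi\<close>, the constant that the normalisation of \<open>fourier\<close> has to
  cancel.\<close>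

lemma gaussian_fourier:
  fixes s \<delta> :: real
  assumes "\<delta> > 0"
  shows "(\<integral>\<xi>. of_real (exp (- (\<delta> * \<xi>)\<^sup>2 / 2)) * iexp (s * \<xi>) \<partial>lborel) =
    complex_of_real (2 * pi * normal_density 0 \<delta> s)"
proof -
  have "of_real (exp (- (s / \<delta>)\<^sup>2 / 2)) = char std_normal_distribution (s / \<delta>)"
    by (simp add: char_std_normal_distribution)
  also have "\<dots> = (\<integral>y. std_normal_density y *\<^sub>R iexp ((s / \<delta>) * y) \<partial>lborel)"
    unfolding char_def by (subst integral_density) auto
  also have "\<dots> = \<bar>\<delta>\<bar> *\<^sub>R (\<integral>\<xi>. std_normal_density (\<delta> * \<xi>) *\<^sub>R iexp ((s / \<delta>) * (\<delta> * \<xi>)) \<partial>lborel)"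
    using lborel_integral_real_affine[of \<delta> "\<lambda>y. std_normal_density y *\<^sub>R iexp ((s / \<delta>) * y)" 0] assms
    by simp
  also have "(\<lambda>\<xi>. std_normal_density (\<delta> * \<xi>) *\<^sub>R iexp ((s / \<delta>) * (\<delta> * \<xi>))) =
      (\<lambda>\<xi>. of_real (1 / sqrt (2 * pi)) * (of_real (exp (- (\<delta> * \<xi>)\<^sup>2 / 2)) * iexp (s * \<xi>)))"
    using assms by (simp add: std_normal_density_def scaleR_conv_of_real fun_eq_iff)
  finally have *: "of_real (exp (- (s / \<delta>)\<^sup>2 / 2)) = complex_of_real (\<delta> / sqrt (2 * pi)) *
      (\<integral>\<xi>. of_real (exp (- (\<delta> * \<xi>)\<^sup>2 / 2)) * iexp (s * \<xi>) \<partial>lborel)"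
    using assms unfolding scaleR_conv_of_real by simp
  have "complex_of_real (2 * pi * normal_density 0 \<delta> s) =
      of_real (sqrt (2 * pi) / \<delta>) * of_real (exp (- (s / \<delta>)\<^sup>2 / 2))"
  proof -
    have "2 * pi / sqrt (2 * pi) = sqrt (2 * pi)"
      by (rule real_div_sqrt) simp
    moreover have "sqrt (2 * pi * \<delta>\<^sup>2) = sqrt (2 * pi) * \<delta>"
      using assms by (simp add: real_sqrt_mult)
    moreover have "2 * pi * (1 / (sqrt (2 * pi) * \<delta>) * r) = 2 * pi / sqrt (2 * pi) / \<delta> * r" for r :: real
      by simp
    ultimately have "2 * pi * normal_density 0 \<delta> s = sqrt (2 * pi) / \<delta> * exp (- (s / \<delta>)\<^sup>2 / 2)"
      unfolding normal_density_def by (simp add: power_divide)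
    then show ?thesis by (simp flip: of_real_mult)
  qed
  also have "\<dots> = (\<integral>\<xi>. of_real (exp (- (\<delta> * \<xi>)\<^sup>2 / 2)) * iexp (s * \<xi>) \<partial>lborel)"
  proof -
    have "complex_of_real (sqrt (2 * pi) / \<delta>) * of_real (\<delta> / sqrt (2 * pi)) = 1"
      unfolding of_real_mult[symmetric] using assms by simp
    then show ?thesis
      unfolding * mult.assoc[symmetric] by simp
  qed
  finally show ?thesis ..
qed

text \<open>Taken over \<open>lborel\<close>, where measurability on product spaces is at hand for
  Fubini; the passage to \<open>lebesgue\<close> is made separately, through Borel versions.\<close>

definition fourier :: "(real \<Rightarrow> complex) \<Rightarrow> real \<Rightarrow> complex" where
  "fourier v \<xi> = complex_of_real ((2 * pi) powr (-1/2)) *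
     (LINT x|lborel. v x * exp (- (\<i> * of_real (x * \<xi>))))"

lemma integrable_fourier:
  assumes "integrable lborel v"
  shows "integrable lborel (\<lambda>x. v x * exp (- (\<i> * of_real (x * \<xi>))))"
proof (rule Bochner_Integration.integrable_bound[OF assms])
  note [measurable] = borel_measurable_integrable[OF assms]
  show "(\<lambda>x. v x * exp (- (\<i> * of_real (x * \<xi>)))) \<in> borel_measurable lborel" by measurable
qed (simp add: norm_mult)

lemma continuous_fourier:
  assumes "integrable lborel v"
  shows "continuous_on UNIV (fourier v)"
proof -
  have "(\<lambda>n. fourier v (X n)) \<longlonglongrightarrow> fourier v \<xi>" if "X \<longlonglongrightarrow> \<xi>" for X \<xi>
    unfolding fourier_def
  proof (intro tendsto_mult tendsto_const integral_dominated_convergence[where w = "\<lambda>x. cmod (v x)"])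
  qed (use assms that in \<open>auto intro!: tendsto_intros simp: norm_mult\<close>)
  then show ?thesis
    by (simp add: continuous_on_sequentially comp_def)
qed

text \<open>A nonintegrable function has Bochner integral 0, so the bound is unconditional. It lets
  the Gaussian double integral be estimated without first establishing that its pieces are
  integrable.\<close>

lemma norm_integral_le_nn_integral:
  fixes f :: "'a \<Rightarrow> 'b :: {banach, second_countable_topology}"
  shows "ennreal (norm (integral\<^sup>L M f)) \<le> (\<integral>\<^sup>+x. ennreal (norm (f x)) \<partial>M)"
  by (cases "integrable M f") (auto simp: integral_norm_bound_ennreal not_integrable_integral_eq)

lemma nn_integral_normal_density:
  assumes "\<delta> > 0"
  shows "(\<integral>\<^sup>+y. ennreal (normal_density x \<delta> y) \<partial>lborel) = 1"
  using assms by (subst nn_integral_eq_integral) auto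

text \<open>Schur's test for the Gaussian kernel, by \<open>2 |v x| |v y| \<le> |v x|\<^sup>2 + |v y|\<^sup>2\<close>.\<close>

lemma normal_density_form_le:
  fixes v :: "real \<Rightarrow> complex"
  assumes [measurable]: "v \<in> borel_measurable lborel" and "\<delta> > 0"
  shows "(\<integral>\<^sup>+x. \<integral>\<^sup>+y. ennreal (cmod (v x) * cmod (v y) * normal_density 0 \<delta> (x - y)) \<partial>lborel \<partial>lborel)
    \<le> (\<integral>\<^sup>+x. ennreal ((cmod (v x))\<^sup>2) \<partial>lborel)"
proof -
  let ?n = "\<lambda>x y. normal_density 0 \<delta> (x - y)"
  let ?g = "\<lambda>x y. ennreal ((cmod (v x))\<^sup>2 / 2) * ennreal (?n x y)"
  let ?N = "\<integral>\<^sup>+x. ennreal ((cmod (v x))\<^sup>2 / 2) \<partial>lborel"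
  have n: "?n x y = normal_density x \<delta> y" "?n x y = normal_density y \<delta> x" for x y
    by (simp_all add: normal_density_def power2_commute)
  have "ennreal (cmod (v x) * cmod (v y) * ?n x y) \<le> ?g x y + ?g y x" for x y
  proof -
    have "cmod (v x) * cmod (v y) * ?n x y \<le> ((cmod (v x))\<^sup>2 / 2 + (cmod (v y))\<^sup>2 / 2) * ?n x y"
      using sum_squares_bound[of "cmod (v x)" "cmod (v y)"] by (intro mult_right_mono) auto
    then have "ennreal (cmod (v x) * cmod (v y) * ?n x y) \<le>
        ennreal ((cmod (v x))\<^sup>2 / 2 * ?n x y + (cmod (v y))\<^sup>2 / 2 * ?n y x)"
      using n by (intro ennreal_leI) (simp add: distrib_right)
    also have "\<dots> = ?g x y + ?g y x"
      by (simp flip: ennreal_mult ennreal_plus)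
    finally show ?thesis .
  qed
  then have "(\<integral>\<^sup>+x. \<integral>\<^sup>+y. ennreal (cmod (v x) * cmod (v y) * ?n x y) \<partial>lborel \<partial>lborel) \<le>
      (\<integral>\<^sup>+x. \<integral>\<^sup>+y. ?g x y + ?g y x \<partial>lborel \<partial>lborel)"
    by (intro nn_integral_mono) auto
  also have "\<dots> = (\<integral>\<^sup>+x. \<integral>\<^sup>+y. ?g x y \<partial>lborel \<partial>lborel) + (\<integral>\<^sup>+x. \<integral>\<^sup>+y. ?g y x \<partial>lborel \<partial>lborel)"
    by (simp add: nn_integral_add)
  also have "(\<integral>\<^sup>+x. \<integral>\<^sup>+y. ?g y x \<partial>lborel \<partial>lborel) = (\<integral>\<^sup>+y. \<integral>\<^sup>+x. ?g y x \<partial>lborel \<partial>lborel)"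
    by (rule lborel_pair.Fubini') measurable
  also have "(\<integral>\<^sup>+x. \<integral>\<^sup>+y. ?g x y \<partial>lborel \<partial>lborel) = ?N"
    using assms by (simp add: nn_integral_cmult n(1) nn_integral_normal_density)
  also have "?N + ?N = (\<integral>\<^sup>+x. ennreal ((cmod (v x))\<^sup>2) \<partial>lborel)"
    by (subst nn_integral_add[symmetric]) (auto simp flip: ennreal_plus)
  finally show ?thesis .
qed

text \<open>Expanding \<open>V * cnj V\<close> and integrating in \<open>\<xi>\<close> first
  replaces the weight by its transform, a normal density in \<open>x - y\<close>. What is left is
  the double integral bounded by Schur's test, and the factor \<open>2 * pi\<close> produced on the
  way cancels against \<open>c\<^sup>2\<close>.\<close>

lemma fourier_gaussian_norm_le:
  fixes v :: "real \<Rightarrow> complex"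
  assumes v: "integrable lborel v" and "\<delta> > 0"
  shows "(\<integral>\<^sup>+\<xi>. ennreal (exp (- (\<delta> * \<xi>)\<^sup>2 / 2) * (cmod (fourier v \<xi>))\<^sup>2) \<partial>lborel)
    \<le> (\<integral>\<^sup>+x. ennreal ((cmod (v x))\<^sup>2) \<partial>lborel)"
proof -
  note [measurable] = borel_measurable_integrable[OF v]
  have [measurable]: "cnj \<in> borel_measurable borel"
    by (intro borel_measurable_continuous_onI continuous_intros)
  define e where "e = (\<lambda>x \<xi> :: real. exp (- (\<i> * complex_of_real (x * \<xi>))))"
  have e [measurable]: "case_prod e \<in> borel_measurable (lborel \<Otimes>\<^sub>M lborel)"
    "case_prod (\<lambda>x y. cnj (e x y)) \<in> borel_measurable (lborel \<Otimes>\<^sub>M lborel)"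
    "case_prod (\<lambda>y x. e x y) \<in> borel_measurable (lborel \<Otimes>\<^sub>M lborel)"
    unfolding e_def split_beta' by measurable
  have e_norm [simp]: "cmod (e x \<xi>) = 1" for x \<xi>
    by (simp add: e_def)
  define V where "V \<xi> = (\<integral>x. v x * e x \<xi> \<partial>lborel)" for \<xi>
  define \<gamma> where "\<gamma> \<xi> = exp (- (\<delta> * \<xi>)\<^sup>2 / 2)" for \<xi>
  define c where "c = (2 * pi) powr (-1/2)"
  have c: "c\<^sup>2 = 1 / (2 * pi)"
    by (simp add: c_def powr_minus power2_eq_square field_simps flip: powr_add)
  have VF: "fourier v \<xi> = of_real c * V \<xi>" for \<xi>
    by (simp add: fourier_def V_def e_def c_def)
  have [measurable]: "V \<in> borel_measurable lborel"
    unfolding V_def by measurable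
  have [measurable]: "\<gamma> \<in> borel_measurable lborel"
    unfolding \<gamma>_def by measurable
  have V_bound: "cmod (V \<xi>) \<le> (\<integral>x. cmod (v x) \<partial>lborel)" for \<xi>
    using integral_norm_bound[of lborel "\<lambda>x. v x * e x \<xi>"] by (simp add: V_def norm_mult)
  have \<gamma>: "integrable lborel \<gamma>"
  proof -
    have "integrable lborel (\<lambda>x. std_normal_density (0 + \<delta> * x))"
      using assms by (subst lborel_integrable_real_affine_iff) auto
    then have "integrable lborel (\<lambda>x. sqrt (2 * pi) * std_normal_density (\<delta> * x))"
      by (intro integrable_mult_right) auto
    then show ?thesis
      by (simp add: std_normal_density_def \<gamma>_def[abs_def])
  qed
  \<comment> \<open>\<open>V\<close> is so far only known to be bounded; the Gaussian weight
    supplies the integrability that Fubini requires.\<close>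
  have \<gamma>V: "integrable lborel (\<lambda>\<xi>. of_real (\<gamma> \<xi>) * cnj (V \<xi>))"
  proof (rule Bochner_Integration.integrable_bound)
    show "integrable lborel (\<lambda>\<xi>. \<gamma> \<xi> * (\<integral>x. cmod (v x) \<partial>lborel))" using \<gamma> by simp
    show "AE \<xi> in lborel. cmod (of_real (\<gamma> \<xi>) * cnj (V \<xi>)) \<le> norm (\<gamma> \<xi> * (\<integral>x. cmod (v x) \<partial>lborel))"
      using V_bound by (intro AE_I2) (simp add: norm_mult abs_mult mult_left_mono)
  qed measurable
  have cnj_V: "cnj (V \<xi>) = (\<integral>y. cnj (v y) * cnj (e y \<xi>) \<partial>lborel)" for \<xi>
    using Bochner_Integration.integral_cnj[of lborel "\<lambda>y. v y * e y \<xi>"] by (simp add: V_def)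
  have inner: "(\<integral>\<xi>. of_real (\<gamma> \<xi>) * cnj (V \<xi>) * e x \<xi> \<partial>lborel) =
      (\<integral>y. cnj (v y) * of_real (2 * pi * normal_density 0 \<delta> (x - y)) \<partial>lborel)" for x
  proof -
    have "(\<integral>\<xi>. of_real (\<gamma> \<xi>) * cnj (V \<xi>) * e x \<xi> \<partial>lborel) =
        (\<integral>\<xi>. of_real (\<gamma> \<xi>) * e x \<xi> * (\<integral>y. cnj (v y) * cnj (e y \<xi>) \<partial>lborel) \<partial>lborel)"
      unfolding cnj_V by (simp add: mult_ac)
    also have "\<dots> = (\<integral>y. cnj (v y) * (\<integral>\<xi>. of_real (\<gamma> \<xi>) * e x \<xi> * cnj (e y \<xi>) \<partial>lborel) \<partial>lborel)"
    proof (rule integral_kernel_swap)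
      show "integrable lborel (\<lambda>\<xi>. of_real (\<gamma> \<xi>) * e x \<xi>)"
        unfolding e_def
        by (rule Bochner_Integration.integrable_bound[OF \<gamma>]) (measurable, simp add: norm_mult)
      show "integrable lborel (\<lambda>y. cnj (v y))" using v by simp
      show "(\<lambda>(\<xi>, y). cnj (e y \<xi>)) \<in> borel_measurable (lborel \<Otimes>\<^sub>M lborel)"
        unfolding e_def by measurable
    qed simp
    also have "(\<lambda>y. \<integral>\<xi>. of_real (\<gamma> \<xi>) * e x \<xi> * cnj (e y \<xi>) \<partial>lborel) =
        (\<lambda>y. of_real (2 * pi * normal_density 0 \<delta> (x - y)))"
    proof
      fix y
      have "e x \<xi> * cnj (e y \<xi>) = iexp ((y - x) * \<xi>)" for \<xi>
        by (simp add: e_def exp_cnj flip: exp_add) (simp add: algebra_simps)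
      then show "(\<integral>\<xi>. of_real (\<gamma> \<xi>) * e x \<xi> * cnj (e y \<xi>) \<partial>lborel) =
          of_real (2 * pi * normal_density 0 \<delta> (x - y))"
        using gaussian_fourier[OF \<open>\<delta> > 0\<close>, of "y - x"]
        by (simp add: \<gamma>_def mult.assoc normal_density_def power2_commute)
    qed
    finally show ?thesis .
  qed
  have "(\<integral>\<xi>. of_real (\<gamma> \<xi>) * cnj (V \<xi>) * V \<xi> \<partial>lborel) =
      (\<integral>x. v x * (\<integral>\<xi>. of_real (\<gamma> \<xi>) * cnj (V \<xi>) * e x \<xi> \<partial>lborel) \<partial>lborel)"
    unfolding V_def[of _]
    by (subst integral_kernel_swap[symmetric, OF \<gamma>V[unfolded V_def] v]) auto
  also have "\<dots> = (\<integral>x. v x * (\<integral>y. cnj (v y) * of_real (2 * pi * normal_density 0 \<delta> (x - y)) \<partial>lborel) \<partial>lborel)"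
    unfolding inner ..
  finally have eq: "(\<integral>\<xi>. of_real (\<gamma> \<xi>) * cnj (V \<xi>) * V \<xi> \<partial>lborel) = \<dots>" .
  define W where "W x = (\<integral>y. cnj (v y) * of_real (2 * pi * normal_density 0 \<delta> (x - y)) \<partial>lborel)" for x
  have W: "ennreal (cmod (v x * W x)) \<le>
      (\<integral>\<^sup>+y. ennreal (2 * pi) * ennreal (cmod (v x) * cmod (v y) * normal_density 0 \<delta> (x - y)) \<partial>lborel)" for x
  proof -
    have "ennreal (cmod (v x * W x)) \<le> ennreal (cmod (v x)) *
        (\<integral>\<^sup>+y. ennreal (cmod (cnj (v y) * of_real (2 * pi * normal_density 0 \<delta> (x - y)))) \<partial>lborel)"
      unfolding W_def norm_mult[of "v x"] by (subst ennreal_mult) (auto intro!: mult_left_mono norm_integral_le_nn_integral)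
    also have "\<dots> = (\<integral>\<^sup>+y. ennreal (cmod (v x)) *
        ennreal (cmod (cnj (v y) * of_real (2 * pi * normal_density 0 \<delta> (x - y)))) \<partial>lborel)"
      by (rule nn_integral_cmult[symmetric]) measurable
    also have "\<dots> = (\<integral>\<^sup>+y. ennreal (2 * pi) * ennreal (cmod (v x) * cmod (v y) * normal_density 0 \<delta> (x - y)) \<partial>lborel)"
      by (simp add: norm_mult mult_ac flip: ennreal_mult)
    finally show ?thesis .
  qed
  have "ennreal (cmod (\<integral>\<xi>. of_real (\<gamma> \<xi>) * cnj (V \<xi>) * V \<xi> \<partial>lborel)) \<le> (\<integral>\<^sup>+x. ennreal (cmod (v x * W x)) \<partial>lborel)"
    unfolding eq W_def by (rule norm_integral_le_nn_integral)
  also have "\<dots> \<le> (\<integral>\<^sup>+x. \<integral>\<^sup>+y. ennreal (2 * pi) *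
      ennreal (cmod (v x) * cmod (v y) * normal_density 0 \<delta> (x - y)) \<partial>lborel \<partial>lborel)"
    by (intro nn_integral_mono W)
  also have "\<dots> = ennreal (2 * pi) * (\<integral>\<^sup>+x. \<integral>\<^sup>+y.
      ennreal (cmod (v x) * cmod (v y) * normal_density 0 \<delta> (x - y)) \<partial>lborel \<partial>lborel)"
    by (simp add: nn_integral_cmult)
  also have "\<dots> \<le> ennreal (2 * pi) * (\<integral>\<^sup>+x. ennreal ((cmod (v x))\<^sup>2) \<partial>lborel)"
    using assms by (intro mult_left_mono normal_density_form_le) auto
  finally have le: "ennreal (cmod (\<integral>\<xi>. of_real (\<gamma> \<xi>) * cnj (V \<xi>) * V \<xi> \<partial>lborel)) \<le> \<dots>" .
  have pt: "of_real (\<gamma> \<xi>) * cnj (V \<xi>) * V \<xi> = of_real (\<gamma> \<xi> * (cmod (V \<xi>))\<^sup>2)" for \<xi>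
    by (simp add: complex_norm_square mult_ac del: of_real_power)
  have int: "integrable lborel (\<lambda>\<xi>. \<gamma> \<xi> * (cmod (V \<xi>))\<^sup>2)"
  proof (rule Bochner_Integration.integrable_bound)
    show "integrable lborel (\<lambda>\<xi>. \<gamma> \<xi> * (\<integral>x. cmod (v x) \<partial>lborel)\<^sup>2)" using \<gamma> by simp
    show "AE \<xi> in lborel. norm (\<gamma> \<xi> * (cmod (V \<xi>))\<^sup>2) \<le> norm (\<gamma> \<xi> * (\<integral>x. cmod (v x) \<partial>lborel)\<^sup>2)"
      using V_bound by (intro AE_I2) (simp add: abs_mult mult_left_mono power_mono)
  qed measurable
  have "(\<integral>\<^sup>+\<xi>. ennreal (\<gamma> \<xi> * (cmod (V \<xi>))\<^sup>2) \<partial>lborel) = ennreal (\<integral>\<xi>. \<gamma> \<xi> * (cmod (V \<xi>))\<^sup>2 \<partial>lborel)"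
    using int by (intro nn_integral_eq_integral) (auto simp: \<gamma>_def)
  also have "\<dots> = ennreal (cmod (\<integral>\<xi>. of_real (\<gamma> \<xi>) * cnj (V \<xi>) * V \<xi> \<partial>lborel))"
    unfolding pt integral_complex_of_real norm_of_real
    by (subst abs_of_nonneg) (auto intro!: integral_nonneg_AE simp: \<gamma>_def)
  finally have "(\<integral>\<^sup>+\<xi>. ennreal (\<gamma> \<xi> * (cmod (V \<xi>))\<^sup>2) \<partial>lborel) \<le>
      ennreal (2 * pi) * (\<integral>\<^sup>+x. ennreal ((cmod (v x))\<^sup>2) \<partial>lborel)"
    using le by simp
  then have "ennreal (1 / (2 * pi)) * (\<integral>\<^sup>+\<xi>. ennreal (\<gamma> \<xi> * (cmod (V \<xi>))\<^sup>2) \<partial>lborel) \<le>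
      ennreal (1 / (2 * pi)) * (ennreal (2 * pi) * (\<integral>\<^sup>+x. ennreal ((cmod (v x))\<^sup>2) \<partial>lborel))"
    by (rule mult_left_mono) simp
  also have "\<dots> = (\<integral>\<^sup>+x. ennreal ((cmod (v x))\<^sup>2) \<partial>lborel)"
    unfolding mult.assoc[symmetric] by (simp flip: ennreal_mult)
  also have "ennreal (1 / (2 * pi)) * (\<integral>\<^sup>+\<xi>. ennreal (\<gamma> \<xi> * (cmod (V \<xi>))\<^sup>2) \<partial>lborel) =
      (\<integral>\<^sup>+\<xi>. ennreal (1 / (2 * pi)) * ennreal (\<gamma> \<xi> * (cmod (V \<xi>))\<^sup>2) \<partial>lborel)"
    by (rule nn_integral_cmult[symmetric]) measurable
  also have "\<dots> = (\<integral>\<^sup>+\<xi>. ennreal (exp (- (\<delta> * \<xi>)\<^sup>2 / 2) * (cmod (fourier v \<xi>))\<^sup>2) \<partial>lborel)"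
    by (simp add: VF norm_mult power_mult_distrib c \<gamma>_def field_simps flip: ennreal_mult)
  finally show ?thesis .
qed

text \<open>Fatou's lemma with \<open>\<delta> = 1 / Suc k\<close>: the weights tend to 1 at every
  point, and the bound for the weighted integrals does not depend on
  \<open>\<delta>\<close>.\<close>

lemma fourier_square_norm_le:
  fixes v :: "real \<Rightarrow> complex"
  assumes v: "integrable lborel v"
  shows "(\<integral>\<^sup>+\<xi>. ennreal ((cmod (fourier v \<xi>))\<^sup>2) \<partial>lborel) \<le> (\<integral>\<^sup>+x. ennreal ((cmod (v x))\<^sup>2) \<partial>lborel)"
proof -
  have [measurable]: "fourier v \<in> borel_measurable lborel"
    using borel_measurable_continuous_onI[OF continuous_fourier[OF v]] by simp
  define f where "f k \<xi> = ennreal (exp (- (1 / real (Suc k) * \<xi>)\<^sup>2 / 2) * (cmod (fourier v \<xi>))\<^sup>2)" for k \<xi>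
  have "(\<lambda>k. exp (- (1 / real (Suc k) * \<xi>)\<^sup>2 / 2) * (cmod (fourier v \<xi>))\<^sup>2) \<longlonglongrightarrow>
      exp (- (0 * \<xi>)\<^sup>2 / 2) * (cmod (fourier v \<xi>))\<^sup>2" for \<xi>
    using LIMSEQ_inverse_real_of_nat by (intro tendsto_intros) (simp_all add: inverse_eq_divide)
  then have "liminf (\<lambda>k. f k \<xi>) = ennreal ((cmod (fourier v \<xi>))\<^sup>2)" for \<xi>
    unfolding f_def by (intro lim_imp_Liminf) (auto intro!: tendsto_ennrealI)
  then have "(\<integral>\<^sup>+\<xi>. ennreal ((cmod (fourier v \<xi>))\<^sup>2) \<partial>lborel) = (\<integral>\<^sup>+\<xi>. liminf (\<lambda>k. f k \<xi>) \<partial>lborel)"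
    by simp
  also have "\<dots> \<le> liminf (\<lambda>k. \<integral>\<^sup>+\<xi>. f k \<xi> \<partial>lborel)"
    by (rule nn_integral_liminf) (simp add: f_def)
  also have "\<dots> \<le> (\<integral>\<^sup>+x. ennreal ((cmod (v x))\<^sup>2) \<partial>lborel)"
    unfolding f_def
    by (intro Liminf_le always_eventually allI fourier_gaussian_norm_le v) simp_all
  finally show ?thesis .
qed

subsection \<open>Integration by parts\<close>

lemma set_integrable_continuous_mult:
  fixes f g :: "real \<Rightarrow> complex"
  assumes f: "continuous_on {a..b} f" and g: "set_integrable lborel {a..b} g"
  shows "set_integrable lborel {a..b} (\<lambda>x. f x * g x)"
proof -
  obtain B where B: "\<And>x. x \<in> {a..b} \<Longrightarrow> cmod (f x) \<le> B"
    using compact_imp_bounded[OF compact_continuous_image[OF f compact_Icc]]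
    by (auto simp: bounded_iff) (metis atLeastAtMost_iff)
  have [measurable]: "(\<lambda>x. indicator {a..b} x *\<^sub>R f x) \<in> borel_measurable lborel"
    "(\<lambda>x. indicator {a..b} x *\<^sub>R g x) \<in> borel_measurable lborel"
    using borel_measurable_continuous_on_indicator[OF _ f] g by (auto simp: set_integrable_def)
  have "integrable lborel (\<lambda>x. (indicator {a..b} x *\<^sub>R f x) * (indicator {a..b} x *\<^sub>R g x))"
  proof (rule Bochner_Integration.integrable_bound)
    show "integrable lborel (\<lambda>x. of_real B * (indicator {a..b} x *\<^sub>R g x))"
      using g unfolding set_integrable_def by (intro integrable_mult_right) auto
    show "AE x in lborel. cmod ((indicator {a..b} x *\<^sub>R f x) * (indicator {a..b} x *\<^sub>R g x))
        \<le> cmod (of_real B * (indicator {a..b} x *\<^sub>R g x))"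
      by (intro AE_I2) (auto simp: norm_mult indicator_def intro!: mult_right_mono order_trans[OF B abs_ge_self])
  qed measurable
  moreover have "(indicator {a..b} x *\<^sub>R f x) * (indicator {a..b} x *\<^sub>R g x) =
      indicator {a..b} x *\<^sub>R (f x * g x)" for x
    by (simp add: indicator_def)
  ultimately show ?thesis
    by (simp only: set_integrable_def)
qed

text \<open>There is no pointwise derivative of \<open>F\<close> to work with. Instead
  \<open>F y - F a\<close> is replaced by the integral of \<open>G\<close> over
  \<open>s \<le> y\<close>, the order of integration over the triangle
  \<open>a \<le> s \<le> y \<le> b\<close> is exchanged, and the fundamental theorem is applied to
  the smooth factor \<open>K\<close> alone.\<close>

lemma integration_by_parts_indefinite:
  fixes F G K K' :: "real \<Rightarrow> complex"
  assumes ab: "a \<le> b" and G: "set_integrable lborel {a..b} G" and contF: "continuous_on {a..b} F"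
    and F: "\<And>y. a \<le> y \<Longrightarrow> y \<le> b \<Longrightarrow> F y - F a = (LINT s:{a..y}|lborel. G s)"
    and K: "\<And>y. a \<le> y \<Longrightarrow> y \<le> b \<Longrightarrow> (K has_vector_derivative K' y) (at y within {a..b})"
    and contK': "continuous_on {a..b} K'"
  shows "(LINT y:{a..b}|lborel. K' y * F y) = K b * F b - K a * F a - (LINT y:{a..b}|lborel. K y * G y)"
proof -
  have contK: "continuous_on {a..b} K"
    using K by (auto intro!: has_vector_derivative_continuous simp: continuous_on_eq_continuous_within)
  have iK': "set_integrable lborel {a..b} K'" and iK'F: "set_integrable lborel {a..b} (\<lambda>y. K' y * F y)"
    using contK' contF by (auto intro!: borel_integrable_atLeastAtMost' continuous_intros)
  have iKG: "set_integrable lborel {a..b} (\<lambda>y. K y * G y)"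
    by (rule set_integrable_continuous_mult[OF contK G])
  have FTC: "(LINT y:{s..b}|lborel. K' y) = K b - K s" if "a \<le> s" "s \<le> b" for s
    unfolding set_lebesgue_integral_def using that
    by (intro integral_FTC_atLeastAtMost)
      (auto intro: has_vector_derivative_within_subset[OF K] continuous_on_subset[OF contK'])
  define A where "A y = indicator {a..b} y *\<^sub>R K' y" for y
  define B where "B s = indicator {a..b} s *\<^sub>R G s" for s
  \<comment> \<open>The indicator of the half-plane below the diagonal. \<open>A\<close> and
    \<open>B\<close> already carry the restriction to \<open>{a..b}\<close>, so their product with
    \<open>k\<close> lives on the triangle.\<close>
  define k where "k y s = (if s \<le> y then 1 else 0 :: complex)" for y s :: real
  have "(\<integral>y. A y * (\<integral>s. B s * k y s \<partial>lborel) \<partial>lborel) = (\<integral>s. B s * (\<integral>y. A y * k y s \<partial>lborel) \<partial>lborel)"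
  proof (rule integral_kernel_swap)
    show "integrable lborel A" "integrable lborel B"
      using iK' G by (auto simp: A_def[abs_def] B_def[abs_def] set_integrable_def)
    show "case_prod k \<in> borel_measurable (lborel \<Otimes>\<^sub>M lborel)"
      unfolding k_def split_beta' by measurable
    show "cmod (k y s) \<le> 1" for y s
      by (simp add: k_def)
  qed
  moreover have "A y * (\<integral>s. B s * k y s \<partial>lborel) = indicator {a..b} y *\<^sub>R (K' y * F y - K' y * F a)" for y
  proof (cases "y \<in> {a..b}")
    case True
    then have "B s * k y s = indicator {a..y} s *\<^sub>R G s" for s
      by (auto simp: B_def k_def indicator_def)
    then show ?thesis
      using True F[of y] by (simp add: A_def set_lebesgue_integral_def algebra_simps)
  qed (simp add: A_def)
  moreover have "B s * (\<integral>y. A y * k y s \<partial>lborel) = indicator {a..b} s *\<^sub>R (K b * G s - K s * G s)" for s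
  proof (cases "s \<in> {a..b}")
    case True
    then have "A y * k y s = indicator {s..b} y *\<^sub>R K' y" for y
      by (auto simp: A_def k_def indicator_def)
    then show ?thesis
      using True FTC[of s] by (simp add: B_def set_lebesgue_integral_def flip: right_diff_distrib) (simp add: algebra_simps)
  qed (simp add: B_def)
  ultimately have "(LINT y:{a..b}|lborel. K' y * F y - K' y * F a) =
      (LINT s:{a..b}|lborel. K b * G s - K s * G s)"
    by (simp add: set_lebesgue_integral_def)
  moreover have "(LINT y:{a..b}|lborel. K' y * F y - K' y * F a) =
      (LINT y:{a..b}|lborel. K' y * F y) - (K b - K a) * F a"
    using iK' iK'F FTC[of a] ab by (simp add: set_integral_diff)
  moreover have "(LINT s:{a..b}|lborel. K b * G s - K s * G s) =
      K b * (F b - F a) - (LINT s:{a..b}|lborel. K s * G s)"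
    using iKG G F[of b] ab by (simp add: set_integral_diff)
  ultimately have "(LINT y:{a..b}|lborel. K' y * F y) - (K b - K a) * F a =
      K b * (F b - F a) - (LINT y:{a..b}|lborel. K y * G y)"
    by simp
  \<comment> \<open>The final rearrangement is a ring identity once the integrals are abstracted to
    variables.\<close>
  moreover have "p = kb * fb - ka * fa - q" if "p - (kb - ka) * fa = kb * (fb - fa) - q"
    for p q ka kb fa fb :: complex
    using that by algebra
  ultimately show ?thesis
    by blast
qed

text \<open>Continuity of the indefinite integral is borrowed from the gauge integral, which agrees
  with the Lebesgue integral here. This version and its mirror image let identities on intervals
  avoiding 0 be extended up to 0.\<close>

lemma set_integral_lower_limit_tendsto:
  fixes f :: "real \<Rightarrow> 'a :: euclidean_space"
  assumes f: "set_integrable lborel {a..b} f" and "a < b"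
  shows "((\<lambda>e. LINT x:{e..b}|lborel. f x) \<longlongrightarrow> (LINT x:{a..b}|lborel. f x)) (at_right a)"
proof -
  have eq: "(LINT x:{e..b}|lborel. f x) = integral {e..b} f" if "e \<in> {a..b}" for e
    using that by (intro set_borel_integral_eq_integral(2) set_integrable_subset[OF f]) auto
  have "continuous_on {a..b} (\<lambda>e. integral {e..b} f)"
    by (intro indefinite_integral_continuous_1' set_borel_integral_eq_integral(1) f)
  then have "continuous_on {a..b} (\<lambda>e. LINT x:{e..b}|lborel. f x)"
    by (subst continuous_on_cong[OF refl eq])
  then show ?thesis
    using \<open>a < b\<close> by (auto simp: continuous_on_def at_within_Icc_at_right dest: bspec[of _ _ a])
qed

lemma set_integral_upper_limit_tendsto:
  fixes f :: "real \<Rightarrow> 'a :: euclidean_space"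
  assumes f: "set_integrable lborel {a..b} f" and "a < b"
  shows "((\<lambda>e. LINT x:{a..e}|lborel. f x) \<longlongrightarrow> (LINT x:{a..b}|lborel. f x)) (at_left b)"
proof -
  have eq: "(LINT x:{a..e}|lborel. f x) = integral {a..e} f" if "e \<in> {a..b}" for e
    using that by (intro set_borel_integral_eq_integral(2) set_integrable_subset[OF f]) auto
  have "continuous_on {a..b} (\<lambda>e. integral {a..e} f)"
    by (intro indefinite_integral_continuous_1 set_borel_integral_eq_integral(1) f)
  then have "continuous_on {a..b} (\<lambda>e. LINT x:{a..e}|lborel. f x)"
    by (subst continuous_on_cong[OF refl eq])
  then show ?thesis
    using \<open>a < b\<close> by (auto simp: continuous_on_def at_within_Icc_at_left dest: bspec[of _ _ b])
qed

section \<open>Behaviour at the origin\<close>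

lemma integrable_imp_set_integrable_Icc:
  fixes f :: "real \<Rightarrow> 'a :: euclidean_space"
  shows "integrable lborel f \<Longrightarrow> set_integrable lborel {a..b} f"
  unfolding set_integrable_def by (rule integrable_mult_indicator) auto

text \<open>If \<open>F 0\<close> were nonzero, continuity would give
  \<open>c \<le> cmod (F \<xi>)\<close> near 0, hence a quotient of at least
  \<open>c / \<eta>\<^sup>2\<close> on \<open>{0<..\<eta>}\<close>. That interval has length
  \<open>\<eta>\<close>, so the integral would be at least \<open>c / \<eta>\<close> for all small
  \<open>\<eta>\<close>. The interval is open at 0 because the quotient there is 0 by
  convention.\<close>

lemma vanishes_at_zero:
  fixes F :: "real \<Rightarrow> complex"
  assumes cont: "continuous_on UNIV F" and int: "integrable lborel (\<lambda>\<xi>. F \<xi> / of_real (\<xi>\<^sup>2))"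
  shows "F 0 = 0"
proof (rule ccontr)
  assume "F 0 \<noteq> 0"
  define c where "c = cmod (F 0) / 2"
  have c: "c > 0" using \<open>F 0 \<noteq> 0\<close> by (simp add: c_def)
  obtain d where d: "d > 0" and dF: "\<And>\<xi>. dist \<xi> 0 < d \<Longrightarrow> dist (F \<xi>) (F 0) < c"
    using cont[unfolded continuous_on_iff] c by (metis UNIV_I)
  have F: "c \<le> cmod (F \<xi>)" if "\<bar>\<xi>\<bar> < d" for \<xi>
    using dF[of \<xi>] that norm_triangle_ineq2[of "F 0" "F \<xi>"] by (simp add: dist_norm norm_minus_commute c_def)
  let ?I = "\<integral>\<xi>. cmod (F \<xi> / of_real (\<xi>\<^sup>2)) \<partial>lborel"
  have I: "c / \<eta> \<le> ?I" if "0 < \<eta>" "\<eta> < d" for \<eta>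
  proof -
    have "c / \<eta> = (\<integral>\<xi>. indicator {0<..\<eta>} \<xi> * (c / \<eta>\<^sup>2) \<partial>lborel)"
      using that by (simp add: power2_eq_square)
    also have "\<dots> \<le> ?I"
    proof (rule integral_mono)
      show "integrable lborel (\<lambda>\<xi>. indicator {0<..\<eta>} \<xi> * (c / \<eta>\<^sup>2))"
        using that by simp
      show "integrable lborel (\<lambda>\<xi>. cmod (F \<xi> / of_real (\<xi>\<^sup>2)))"
        using int by (rule integrable_norm)
      show "indicator {0<..\<eta>} \<xi> * (c / \<eta>\<^sup>2) \<le> cmod (F \<xi> / of_real (\<xi>\<^sup>2))" for \<xi>
      proof (cases "\<xi> \<in> {0<..\<eta>}")
        case True
        then have "c / \<eta>\<^sup>2 \<le> cmod (F \<xi>) / \<xi>\<^sup>2"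
          using that c F[of \<xi>] by (intro frac_le power_mono) auto
        then show ?thesis
          using True by (simp add: norm_divide norm_power)
      qed simp
    qed
    finally show ?thesis .
  qed
  \<comment> \<open>Half of \<open>d\<close> keeps \<open>\<eta>\<close> inside the neighbourhood of
    continuity; \<open>c / (?I + 1)\<close> forces \<open>c / \<eta>\<close> to be at least
    \<open>?I + 1\<close>, against the bound \<open>?I\<close>. The summand 1 also keeps the
    denominator positive when \<open>?I\<close> is 0.\<close>
  define \<eta> where "\<eta> = min (d / 2) (c / (?I + 1))"
  have "?I \<ge> 0" by (rule Bochner_Integration.integral_nonneg) simp
  then have pos: "0 < \<eta>" "\<eta> < d" "\<eta> \<le> c / (?I + 1)"
    using c d by (auto simp: \<eta>_def min_less_iff_disj intro!: divide_pos_pos add_nonneg_pos)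
  then have "\<eta> * (?I + 1) \<le> c"
    using \<open>?I \<ge> 0\<close> pos_le_divide_eq[of "?I + 1" \<eta> c] by linarith
  then have "?I + 1 \<le> c / \<eta>"
    using pos by (simp add: pos_le_divide_eq mult.commute)
  with I[OF pos(1,2)] show False by linarith
qed

text \<open>The factor lost in passing from \<open>h s\<close> to \<open>h s / s\<close> is
  \<open>\<bar>s\<bar>\<close>, at most the length \<open>d\<close> of the interval, and
  \<open>d\<close> cancels in the quotient. Requiring both that the length is \<open>d\<close> and
  that \<open>\<bar>s\<bar> \<le> d\<close> covers intervals ending at 0 from either side.\<close>

lemma difference_quotient_bound:
  fixes F h :: "real \<Rightarrow> complex"
  assumes h: "set_integrable lborel {a..b} h" "F b - F a = (LINT s:{a..b}|lborel. h s)"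
    and hs: "set_integrable lborel {a..b} (\<lambda>s. h s / of_real s)"
    and ab: "a < b" "b - a = d" "\<And>s. s \<in> {a..b} \<Longrightarrow> \<bar>s\<bar> \<le> d"
  shows "cmod ((F b - F a) / of_real d) \<le> (LINT s:{a..b}|lborel. cmod (h s / of_real s))"
proof -
  have "cmod (F b - F a) \<le> (LINT s:{a..b}|lborel. cmod (h s))"
    unfolding h(2) by (rule set_integral_norm_bound) fact
  also have "\<dots> \<le> (LINT s:{a..b}|lborel. d * cmod (h s / of_real s))"
    unfolding set_lebesgue_integral_def
  proof (rule integral_mono_AE)
    show "integrable lborel (\<lambda>s. indicat_real {a..b} s *\<^sub>R cmod (h s))"
      using set_integrable_norm[OF h(1)] by (simp add: set_integrable_def)
    show "integrable lborel (\<lambda>s. indicat_real {a..b} s *\<^sub>R (d * cmod (h s / of_real s)))"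
      using set_integrable_mult_right[OF set_integrable_norm[OF hs], of d] by (simp add: set_integrable_def)
    \<comment> \<open>At \<open>s = 0\<close> the right side is 0 by the convention on division, so
      the inequality may fail there; a single point is negligible.\<close>
    show "AE s in lborel. indicat_real {a..b} s *\<^sub>R cmod (h s) \<le> indicat_real {a..b} s *\<^sub>R (d * cmod (h s / of_real s))"
      using AE_lborel_singleton[of 0]
    proof eventually_elim
      case (elim s)
      have "cmod (h s) \<le> d * cmod (h s / of_real s)" if "s \<in> {a..b}"
      proof -
        have "\<bar>s\<bar> * cmod (h s / of_real s) \<le> d * cmod (h s / of_real s)"
          using ab(3)[OF that] by (intro mult_right_mono) auto
        then show ?thesis using elim by (simp add: norm_divide)
      qed
      then show ?case by (simp add: indicator_def)
    qed
  qed
  also have "\<dots> = d * (LINT s:{a..b}|lborel. cmod (h s / of_real s))"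
    by (rule set_integral_mult_right)
  finally show ?thesis
    using ab(1,2) by (simp add: norm_divide pos_divide_le_eq mult.commute)
qed

subsection \<open>The oscillatory integral\<close>

definition phase :: "real \<Rightarrow> real \<Rightarrow> real \<Rightarrow> complex" where
  "phase t x \<xi> = exp (\<i> * of_real (x * \<xi>)) * exp (- (\<i> * of_real (t * \<xi>\<^sup>2 / 2)))"

lemma norm_phase [simp]: "cmod (phase t x \<xi>) = 1"
  by (simp add: phase_def norm_mult)

lemma phase_derivative:
  "(phase t x has_vector_derivative (\<i> * of_real x - \<i> * of_real (t * \<xi>)) * phase t x \<xi>) (at \<xi> within S)"
  unfolding phase_def
  by (rule has_vector_derivative_eq_rhs, (rule derivative_eq_intros has_vector_derivative_real_field refl | simp)+)
    (simp add: algebra_simps)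

lemma continuous_phase: "continuous_on S (phase t x)"
  unfolding phase_def by (auto intro!: continuous_intros)

text \<open>With \<open>e\<close> the phase,
  \<open>\<i> * t * e * F = (\<i> * x * e - e') * F / \<xi>\<close>. The first term here is kept as
  it stands; the other two are \<open>e\<close> times the formal derivative of
  \<open>F / \<xi>\<close>. The parameter \<open>t\<close> survives only inside the unimodular
  phase.\<close>

definition phase_remainder :: "(real \<Rightarrow> complex) \<Rightarrow> (real \<Rightarrow> complex) \<Rightarrow> real \<Rightarrow> real \<Rightarrow> real \<Rightarrow> complex" where
  "phase_remainder F h t x \<xi> = \<i> * of_real x * (phase t x \<xi> * (F \<xi> / of_real \<xi>))
     - phase t x \<xi> * (F \<xi> / of_real (\<xi>\<^sup>2)) + phase t x \<xi> * (h \<xi> / of_real \<xi>)"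

text \<open>With \<open>K\<close> the phase divided by \<open>\<xi>\<close>, the integrand is
  pointwise the remainder minus \<open>K' * F + K * h\<close>. The latter is the formal derivative
  of \<open>K * F\<close>, so its integral is the boundary term.\<close>

lemma phase_integral_by_parts:
  fixes F h :: "real \<Rightarrow> complex"
  assumes cont: "continuous_on UNIV F"
    and h: "\<And>a b. a \<le> b \<Longrightarrow> set_integrable lborel {a..b} h"
    and Fh: "\<And>a b. a \<le> b \<Longrightarrow> F b - F a = (LINT s:{a..b}|lborel. h s)"
    and ab: "a \<le> b" "0 \<notin> {a..b}"
  shows "\<i> * of_real t * (LINT \<xi>:{a..b}|lborel. phase t x \<xi> * F \<xi>) =
    (LINT \<xi>:{a..b}|lborel. phase_remainder F h t x \<xi>)
      - (phase t x b * (F b / of_real b) - phase t x a * (F a / of_real a))"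
proof -
  define K where "K \<xi> = phase t x \<xi> / of_real \<xi>" for \<xi>
  define K' where "K' \<xi> = (\<i> * of_real x - \<i> * of_real (t * \<xi>)) * phase t x \<xi> / of_real \<xi>
      - phase t x \<xi> / of_real (\<xi>\<^sup>2)" for \<xi>
  have nz: "\<xi> \<noteq> 0" if "\<xi> \<in> {a..b}" for \<xi>
    using that ab by auto
  have contF: "continuous_on {a..b} F"
    using cont by (rule continuous_on_subset) simp
  have contp: "continuous_on {a..b} (phase t x)" by (rule continuous_phase)
  have K: "(K has_vector_derivative K' \<xi>) (at \<xi> within {a..b})" if "\<xi> \<in> {a..b}" for \<xi>
  proof -
    have "((\<lambda>\<xi>. inverse (complex_of_real \<xi>)) has_vector_derivative - (inverse (of_real \<xi>) * 1 * inverse (of_real \<xi>)))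
        (at \<xi> within {a..b})"
      by (rule has_vector_derivative_real_field, rule derivative_intros, rule derivative_intros) (use nz[OF that] in simp)
    from has_vector_derivative_mult[OF phase_derivative[of t x] this]
    show ?thesis
      unfolding K_def[abs_def] K'_def by (simp add: divide_inverse power2_eq_square algebra_simps)
  qed
  have contK': "continuous_on {a..b} K'"
    unfolding K'_def by (intro continuous_intros contp) (use nz in auto)
  have 1: "(LINT \<xi>:{a..b}|lborel. K' \<xi> * F \<xi>) = K b * F b - K a * F a - (LINT \<xi>:{a..b}|lborel. K \<xi> * h \<xi>)"
  proof (rule integration_by_parts_indefinite[OF ab(1) h[OF ab(1)] contF _ _ contK'])
    show "F y - F a = (LINT s:{a..y}|lborel. h s)" if "a \<le> y" for y
      using that by (rule Fh)
    show "(K has_vector_derivative K' y) (at y within {a..b})" if "a \<le> y" "y \<le> b" for y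
      using that by (intro K) simp
  qed
  have iKh: "set_integrable lborel {a..b} (\<lambda>\<xi>. K \<xi> * h \<xi>)"
    using K by (intro set_integrable_continuous_mult h ab)
      (metis continuous_on_eq_continuous_within has_vector_derivative_continuous)
  have ipF: "set_integrable lborel {a..b} (\<lambda>\<xi>. phase t x \<xi> * F \<xi>)"
    by (intro borel_integrable_atLeastAtMost' continuous_intros contF contp)
  have iK'F: "set_integrable lborel {a..b} (\<lambda>\<xi>. K' \<xi> * F \<xi>)"
    by (intro borel_integrable_atLeastAtMost' continuous_intros contF contK')
  have "\<i> * of_real t * (LINT \<xi>:{a..b}|lborel. phase t x \<xi> * F \<xi>) =
      (LINT \<xi>:{a..b}|lborel. \<i> * of_real t * (phase t x \<xi> * F \<xi>))"
    by (rule set_integral_mult_right[symmetric])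
  also have "\<dots> = (LINT \<xi>:{a..b}|lborel. phase_remainder F h t x \<xi> - (K' \<xi> * F \<xi> + K \<xi> * h \<xi>))"
  proof (intro set_lebesgue_integral_cong allI impI)
    fix \<xi> assume "\<xi> \<in> {a..b}"
    from nz[OF this] show "\<i> * of_real t * (phase t x \<xi> * F \<xi>) =
        phase_remainder F h t x \<xi> - (K' \<xi> * F \<xi> + K \<xi> * h \<xi>)"
      unfolding phase_remainder_def K'_def K_def by (simp add: field_simps power2_eq_square)
  qed simp
  also have "\<dots> = (LINT \<xi>:{a..b}|lborel. phase_remainder F h t x \<xi>) - (LINT \<xi>:{a..b}|lborel. K' \<xi> * F \<xi> + K \<xi> * h \<xi>)"
  proof (rule set_integral_diff(2))
    \<comment> \<open>Integrability of the remainder on \<open>{a..b}\<close> comes from the same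
      pointwise identity, solved for the remainder.\<close>
    have "set_integrable lborel {a..b} (\<lambda>\<xi>. \<i> * of_real t * (phase t x \<xi> * F \<xi>) + (K' \<xi> * F \<xi> + K \<xi> * h \<xi>))"
      by (intro set_integral_add set_integrable_mult_right ipF iK'F iKh)
    also have "?this \<longleftrightarrow> set_integrable lborel {a..b} (phase_remainder F h t x)"
    proof (intro set_integrable_cong refl)
      fix \<xi> assume "\<xi> \<in> {a..b}"
      from nz[OF this] show "\<i> * of_real t * (phase t x \<xi> * F \<xi>) + (K' \<xi> * F \<xi> + K \<xi> * h \<xi>) =
          phase_remainder F h t x \<xi>"
        unfolding phase_remainder_def K'_def K_def by (simp add: field_simps power2_eq_square)
    qed
    finally show "set_integrable lborel {a..b} (phase_remainder F h t x)" .
    show "set_integrable lborel {a..b} (\<lambda>\<xi>. K' \<xi> * F \<xi> + K \<xi> * h \<xi>)"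
      by (intro set_integral_add iK'F iKh)
  qed
  also have "(LINT \<xi>:{a..b}|lborel. K' \<xi> * F \<xi> + K \<xi> * h \<xi>) = K b * F b - K a * F a"
    using set_integral_add(2)[OF iK'F iKh] 1 by simp
  finally show ?thesis
    by (simp add: K_def)
qed


lemma integral_Icc_split:
  fixes f :: "real \<Rightarrow> 'a :: euclidean_space"
  assumes f: "set_integrable lborel {a..b} f" and "a \<le> c" "c \<le> b"
  shows "(LINT x:{a..b}|lborel. f x) = (LINT x:{a..c}|lborel. f x) + (LINT x:{c..b}|lborel. f x)"
proof -
  have "(LINT x:{a..b}|lborel. f x) = (LINT x:{a..c} \<union> {c<..b}|lborel. f x)"
    using assms(2,3) by (simp add: ivl_disj_un)
  also have "\<dots> = (LINT x:{a..c}|lborel. f x) + (LINT x:{c<..b}|lborel. f x)"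
    using assms by (intro set_integral_Un set_integrable_subset[OF f]) auto
  also have "(LINT x:{c<..b}|lborel. f x) = (LINT x:{c..b}|lborel. f x)"
    unfolding set_lebesgue_integral_def
  proof (rule integral_cong_AE)
    have "set_integrable lborel {c<..b} f" "set_integrable lborel {c..b} f"
      using assms by (auto intro!: set_integrable_subset[OF f])
    then show "(\<lambda>x. indicat_real {c<..b} x *\<^sub>R f x) \<in> borel_measurable lborel"
      "(\<lambda>x. indicat_real {c..b} x *\<^sub>R f x) \<in> borel_measurable lborel"
      by (auto simp: set_integrable_def)
    show "AE x in lborel. indicat_real {c<..b} x *\<^sub>R f x = indicat_real {c..b} x *\<^sub>R f x"
      using AE_lborel_singleton[of c] by eventually_elim (auto simp: indicator_def)
  qed
  finally show ?thesis .
qed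

section \<open>Passage to the limit at the origin and at infinity\<close>

context
  fixes F h :: "real \<Rightarrow> complex" and M :: real
  assumes cont: "continuous_on UNIV F" and bound: "\<And>\<xi>. cmod (F \<xi>) \<le> M"
    and h: "\<And>a b. a \<le> b \<Longrightarrow> set_integrable lborel {a..b} h"
    and Fh: "\<And>a b. a \<le> b \<Longrightarrow> F b - F a = (LINT s:{a..b}|lborel. h s)"
    and F1: "integrable lborel (\<lambda>\<xi>. F \<xi> / of_real \<xi>)"
    and F2: "integrable lborel (\<lambda>\<xi>. F \<xi> / of_real (\<xi>\<^sup>2))"
    and h1: "integrable lborel (\<lambda>\<xi>. h \<xi> / of_real \<xi>)"
begin

lemma zero_at_origin: "F 0 = 0"
  by (rule vanishes_at_zero[OF cont F2])

lemma quotient_tendsto_right: "((\<lambda>e. F e / of_real e) \<longlongrightarrow> 0) (at_right 0)"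
proof -
  let ?q = "\<lambda>s. cmod (h s / of_real s)"
  have q: "set_integrable lborel {a..b} ?q" for a b
    using h1 by (intro integrable_imp_set_integrable_Icc integrable_norm)
  have "((\<lambda>e. (LINT s:{0..1}|lborel. ?q s) - (LINT s:{e..1}|lborel. ?q s)) \<longlongrightarrow>
      (LINT s:{0..1}|lborel. ?q s) - (LINT s:{0..1}|lborel. ?q s)) (at_right 0)"
    by (intro tendsto_diff tendsto_const set_integral_lower_limit_tendsto q) simp
  then have lim: "((\<lambda>e. (LINT s:{0..1}|lborel. ?q s) - (LINT s:{e..1}|lborel. ?q s)) \<longlongrightarrow> 0) (at_right 0)"
    by simp
  show ?thesis
  proof (rule Lim_null_comparison[OF _ lim], rule eventually_at_rightI[of 0 1])
    fix e :: real assume e: "e \<in> {0<..<1}"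
    have "cmod ((F e - F 0) / of_real e) \<le> (LINT s:{0..e}|lborel. ?q s)"
      using e by (intro difference_quotient_bound[where d = e] h Fh integrable_imp_set_integrable_Icc h1) auto
    also have "\<dots> = (LINT s:{0..1}|lborel. ?q s) - (LINT s:{e..1}|lborel. ?q s)"
      using integral_Icc_split[OF q, of 0 e 1] e by simp
    finally show "cmod (F e / of_real e) \<le> \<dots>"
      by (simp add: zero_at_origin)
  qed simp
qed

lemma quotient_tendsto_left: "((\<lambda>e. F e / of_real e) \<longlongrightarrow> 0) (at_left 0)"
proof -
  let ?q = "\<lambda>s. cmod (h s / of_real s)"
  have q: "set_integrable lborel {a..b} ?q" for a b
    using h1 by (intro integrable_imp_set_integrable_Icc integrable_norm)
  have "((\<lambda>e. (LINT s:{-1..0}|lborel. ?q s) - (LINT s:{-1..e}|lborel. ?q s)) \<longlongrightarrow>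
      (LINT s:{-1..0}|lborel. ?q s) - (LINT s:{-1..0}|lborel. ?q s)) (at_left 0)"
    by (intro tendsto_diff tendsto_const set_integral_upper_limit_tendsto q) simp
  then have lim: "((\<lambda>e. (LINT s:{-1..0}|lborel. ?q s) - (LINT s:{-1..e}|lborel. ?q s)) \<longlongrightarrow> 0) (at_left 0)"
    by simp
  show ?thesis
  proof (rule Lim_null_comparison[OF _ lim], rule eventually_at_leftI[of "-1" 0])
    fix e :: real assume e: "e \<in> {-1<..<0}"
    have "cmod ((F 0 - F e) / of_real (- e)) \<le> (LINT s:{e..0}|lborel. ?q s)"
      using e by (intro difference_quotient_bound h Fh integrable_imp_set_integrable_Icc h1) auto
    also have "\<dots> = (LINT s:{-1..0}|lborel. ?q s) - (LINT s:{-1..e}|lborel. ?q s)"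
      using integral_Icc_split[OF q, of "-1" e 0] e by simp
    finally show "cmod (F e / of_real e) \<le> \<dots>"
      by (simp add: zero_at_origin)
  qed simp
qed

lemma phase_mult_integrable:
  assumes "integrable lborel f"
  shows "integrable lborel (\<lambda>\<xi>. phase t x \<xi> * f \<xi>)"
proof (rule Bochner_Integration.integrable_bound[OF assms])
  have [measurable]: "phase t x \<in> borel_measurable lborel" "f \<in> borel_measurable lborel"
    using borel_measurable_continuous_onI[OF continuous_phase] assms by auto
  show "(\<lambda>\<xi>. phase t x \<xi> * f \<xi>) \<in> borel_measurable lborel" by measurable
qed (simp add: norm_mult)

lemma integrable_remainder: "integrable lborel (phase_remainder F h t x)"
  unfolding phase_remainder_def[abs_def]
  by (intro Bochner_Integration.integrable_add Bochner_Integration.integrable_diff integrable_mult_right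
      phase_mult_integrable F1 F2 h1)

text \<open>The parameter \<open>x\<close> enters, apart from the phase, through the coefficient of
  a single term; this is where the linear growth in \<open>x\<close> comes from.\<close>

lemma remainder_bound:
  "cmod (\<integral>\<xi>. phase_remainder F h t x \<xi> \<partial>lborel) \<le>
    ((\<integral>\<xi>. cmod (F \<xi> / of_real \<xi>) \<partial>lborel) + (\<integral>\<xi>. cmod (F \<xi> / of_real (\<xi>\<^sup>2)) \<partial>lborel)
      + (\<integral>\<xi>. cmod (h \<xi> / of_real \<xi>) \<partial>lborel)) * (1 + \<bar>x\<bar>)"
  (is "_ \<le> (?A + ?B + ?D) * _")
proof -
  have "cmod (\<integral>\<xi>. phase_remainder F h t x \<xi> \<partial>lborel) \<le> (\<integral>\<xi>. cmod (phase_remainder F h t x \<xi>) \<partial>lborel)"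
    by (rule integral_norm_bound)
  also have "\<dots> \<le> (\<integral>\<xi>. \<bar>x\<bar> * cmod (F \<xi> / of_real \<xi>) + cmod (F \<xi> / of_real (\<xi>\<^sup>2)) + cmod (h \<xi> / of_real \<xi>) \<partial>lborel)"
  proof (rule integral_mono)
    show "integrable lborel (\<lambda>\<xi>. cmod (phase_remainder F h t x \<xi>))"
      by (intro integrable_norm integrable_remainder)
    show "integrable lborel (\<lambda>\<xi>. \<bar>x\<bar> * cmod (F \<xi> / of_real \<xi>) + cmod (F \<xi> / of_real (\<xi>\<^sup>2)) + cmod (h \<xi> / of_real \<xi>))"
      by (intro Bochner_Integration.integrable_add integrable_mult_right integrable_norm F1 F2 h1)
    fix \<xi>
    have "cmod (u - v + w) \<le> cmod u + cmod v + cmod w" for u v w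
      by (meson add_mono norm_triangle_ineq norm_triangle_ineq4 order_refl order_trans)
    from this[of "\<i> * of_real x * (phase t x \<xi> * (F \<xi> / of_real \<xi>))" "phase t x \<xi> * (F \<xi> / of_real (\<xi>\<^sup>2))"
        "phase t x \<xi> * (h \<xi> / of_real \<xi>)"]
    show "cmod (phase_remainder F h t x \<xi>) \<le>
        \<bar>x\<bar> * cmod (F \<xi> / of_real \<xi>) + cmod (F \<xi> / of_real (\<xi>\<^sup>2)) + cmod (h \<xi> / of_real \<xi>)"
      unfolding phase_remainder_def norm_mult norm_phase by simp
  qed
  also have "\<dots> = \<bar>x\<bar> * ?A + ?B + ?D"
    using F1 F2 h1 by (simp add: integrable_norm)
  also have "\<dots> \<le> (?A + ?B + ?D) * (1 + \<bar>x\<bar>)"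
    by (simp add: algebra_simps)
  finally show ?thesis .
qed

text \<open>The identity holds on intervals that stop short of 0. Letting them grow to 0 from the
  right and from the left, both sides converge, and uniqueness of limits gives the identity on each
  half of \<open>{-R..R}\<close>.\<close>

lemma truncated_phase_integral:
  assumes "R > 0"
  shows "\<i> * of_real t * (LINT \<xi>:{-R..R}|lborel. phase t x \<xi> * F \<xi>) =
    (LINT \<xi>:{-R..R}|lborel. phase_remainder F h t x \<xi>)
      - (phase t x R * (F R / of_real R) - phase t x (-R) * (F (-R) / of_real (-R)))"
proof -
  let ?f = "\<lambda>\<xi>. phase t x \<xi> * F \<xi>"
  let ?r = "phase_remainder F h t x"
  have i_f: "set_integrable lborel {a..b} ?f" for a b
    by (intro borel_integrable_atLeastAtMost' continuous_intros continuous_phase continuous_on_subset[OF cont]) auto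
  have ir: "set_integrable lborel {a..b} ?r" for a b
    by (intro integrable_imp_set_integrable_Icc integrable_remainder)
  \<comment> \<open>The phase oscillates but has modulus 1, so the inner boundary term vanishes on
    each side separately.\<close>
  have p: "((\<lambda>e. phase t x e * (F e / of_real e)) \<longlongrightarrow> 0) G"
    if "((\<lambda>e. F e / of_real e) \<longlongrightarrow> 0) G" for G
    using that by (rule Lim_null_comparison[OF always_eventually, rotated, OF tendsto_norm_zero]) (simp add: norm_mult norm_divide)
  have right: "\<i> * of_real t * (LINT \<xi>:{0..R}|lborel. ?f \<xi>) =
      (LINT \<xi>:{0..R}|lborel. ?r \<xi>) - (phase t x R * (F R / of_real R) - 0)"
  proof (rule tendsto_unique[OF trivial_limit_at_right_real])
    show "((\<lambda>e. \<i> * of_real t * (LINT \<xi>:{e..R}|lborel. ?f \<xi>)) \<longlongrightarrow> \<i> * of_real t * (LINT \<xi>:{0..R}|lborel. ?f \<xi>)) (at_right 0)"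
      by (intro tendsto_intros set_integral_lower_limit_tendsto i_f assms)
    have "((\<lambda>e. (LINT \<xi>:{e..R}|lborel. ?r \<xi>) - (phase t x R * (F R / of_real R) - phase t x e * (F e / of_real e)))
        \<longlongrightarrow> (LINT \<xi>:{0..R}|lborel. ?r \<xi>) - (phase t x R * (F R / of_real R) - 0)) (at_right 0)"
      by (intro tendsto_diff tendsto_const p quotient_tendsto_right set_integral_lower_limit_tendsto ir assms)
    then show "((\<lambda>e. \<i> * of_real t * (LINT \<xi>:{e..R}|lborel. ?f \<xi>))
        \<longlongrightarrow> (LINT \<xi>:{0..R}|lborel. ?r \<xi>) - (phase t x R * (F R / of_real R) - 0)) (at_right 0)"
    proof (rule Lim_transform_eventually, intro eventually_at_rightI[of 0 R])
      fix e assume "e \<in> {0<..<R}"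
      then show "(LINT \<xi>:{e..R}|lborel. ?r \<xi>) - (phase t x R * (F R / of_real R) - phase t x e * (F e / of_real e)) =
          \<i> * of_real t * (LINT \<xi>:{e..R}|lborel. ?f \<xi>)"
        by (intro phase_integral_by_parts[symmetric] cont h Fh) auto
    qed (use assms in simp)
  qed
  have left: "\<i> * of_real t * (LINT \<xi>:{-R..0}|lborel. ?f \<xi>) =
      (LINT \<xi>:{-R..0}|lborel. ?r \<xi>) - (0 - phase t x (-R) * (F (-R) / of_real (-R)))"
  proof (rule tendsto_unique[OF trivial_limit_at_left_real])
    show "((\<lambda>e. \<i> * of_real t * (LINT \<xi>:{-R..e}|lborel. ?f \<xi>)) \<longlongrightarrow> \<i> * of_real t * (LINT \<xi>:{-R..0}|lborel. ?f \<xi>)) (at_left 0)"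
      using assms by (intro tendsto_intros set_integral_upper_limit_tendsto i_f) simp
    have "((\<lambda>e. (LINT \<xi>:{-R..e}|lborel. ?r \<xi>) - (phase t x e * (F e / of_real e) - phase t x (-R) * (F (-R) / of_real (-R))))
        \<longlongrightarrow> (LINT \<xi>:{-R..0}|lborel. ?r \<xi>) - (0 - phase t x (-R) * (F (-R) / of_real (-R)))) (at_left 0)"
      using assms by (intro tendsto_diff tendsto_const p quotient_tendsto_left set_integral_upper_limit_tendsto ir) simp
    then show "((\<lambda>e. \<i> * of_real t * (LINT \<xi>:{-R..e}|lborel. ?f \<xi>))
        \<longlongrightarrow> (LINT \<xi>:{-R..0}|lborel. ?r \<xi>) - (0 - phase t x (-R) * (F (-R) / of_real (-R)))) (at_left 0)"
    proof (rule Lim_transform_eventually, intro eventually_at_leftI[of "-R" 0])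
      fix e assume "e \<in> {-R<..<0}"
      then show "(LINT \<xi>:{-R..e}|lborel. ?r \<xi>) - (phase t x e * (F e / of_real e) - phase t x (-R) * (F (-R) / of_real (-R))) =
          \<i> * of_real t * (LINT \<xi>:{-R..e}|lborel. ?f \<xi>)"
        by (intro phase_integral_by_parts[symmetric] cont h Fh) auto
    qed (use assms in simp)
  qed
  show ?thesis
    using left right integral_Icc_split[OF i_f, of "-R" 0 R] integral_Icc_split[OF ir, of "-R" 0 R] assms
    by (simp add: distrib_left)
qed

lemma phase_integral_limit:
  assumes "t \<noteq> 0"
  shows "((\<lambda>R. LINT \<xi>:{-R..R}|lborel. phase t x \<xi> * F \<xi>) \<longlongrightarrow>
    (\<integral>\<xi>. phase_remainder F h t x \<xi> \<partial>lborel) / (\<i> * of_real t)) at_top"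
proof -
  let ?r = "phase_remainder F h t x"
  have 1: "((\<lambda>R. LINT \<xi>:{-R..R}|lborel. ?r \<xi>) \<longlongrightarrow> (\<integral>\<xi>. ?r \<xi> \<partial>lborel)) at_top"
    unfolding set_lebesgue_integral_def
  proof (rule integral_dominated_convergence_at_top[where w = "\<lambda>\<xi>. cmod (?r \<xi>)"])
    show "AE \<xi> in lborel. ((\<lambda>R. indicator {-R..R} \<xi> *\<^sub>R ?r \<xi>) \<longlongrightarrow> ?r \<xi>) at_top"
    proof (intro AE_I2 tendsto_eventually)
      show "\<forall>\<^sub>F R in at_top. indicator {-R..R} \<xi> *\<^sub>R ?r \<xi> = ?r \<xi>" for \<xi>
        using eventually_ge_at_top[of "\<bar>\<xi>\<bar>"] by eventually_elim (auto simp: indicator_def)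
    qed
    show "\<forall>\<^sub>F R in at_top. AE \<xi> in lborel. cmod (indicator {-R..R} \<xi> *\<^sub>R ?r \<xi>) \<le> cmod (?r \<xi>)"
      by (intro always_eventually allI AE_I2) (simp add: indicator_def)
  qed (use integrable_remainder[of t x] in \<open>auto intro: borel_measurable_integrable\<close>)
  \<comment> \<open>The values 1 and -1 of \<open>c\<close> give the boundary terms at the two
    ends.\<close>
  have q: "((\<lambda>R. phase t x (c * R) * (F (c * R) / of_real (c * R))) \<longlongrightarrow> 0) at_top" if "\<bar>c\<bar> = 1" for c
  proof (rule Lim_null_comparison)
    show "((\<lambda>R. M / R) \<longlongrightarrow> 0) at_top"
      by (intro tendsto_divide_0[OF tendsto_const] filterlim_at_top_imp_at_infinity filterlim_ident)
    show "\<forall>\<^sub>F R in at_top. cmod (phase t x (c * R) * (F (c * R) / of_real (c * R))) \<le> M / R"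
      using eventually_gt_at_top[of 0]
    proof eventually_elim
      case (elim R)
      then show ?case
        using bound[of "c * R"] that by (simp add: norm_mult norm_divide abs_mult divide_right_mono)
    qed
  qed
  have "((\<lambda>R. ((LINT \<xi>:{-R..R}|lborel. ?r \<xi>) -
      (phase t x (1 * R) * (F (1 * R) / of_real (1 * R)) - phase t x (-1 * R) * (F (-1 * R) / of_real (-1 * R)))) / (\<i> * of_real t))
      \<longlongrightarrow> ((\<integral>\<xi>. ?r \<xi> \<partial>lborel) - (0 - 0)) / (\<i> * of_real t)) at_top"
    using assms by (intro tendsto_diff tendsto_divide tendsto_const 1 q) auto
  then have "((\<lambda>R. ((LINT \<xi>:{-R..R}|lborel. ?r \<xi>) -
      (phase t x R * (F R / of_real R) - phase t x (-R) * (F (-R) / of_real (-R)))) / (\<i> * of_real t))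
      \<longlongrightarrow> (\<integral>\<xi>. ?r \<xi> \<partial>lborel) / (\<i> * of_real t)) at_top"
    by simp
  then show ?thesis
  proof (rule Lim_transform_eventually)
    show "\<forall>\<^sub>F R in at_top. ((LINT \<xi>:{-R..R}|lborel. ?r \<xi>) -
        (phase t x R * (F R / of_real R) - phase t x (-R) * (F (-R) / of_real (-R)))) / (\<i> * of_real t) =
        (LINT \<xi>:{-R..R}|lborel. phase t x \<xi> * F \<xi>)"
      using eventually_gt_at_top[of 0]
    proof eventually_elim
      case (elim R)
      show ?case
        unfolding truncated_phase_integral[OF elim, symmetric] using assms by simp
    qed
  qed
qed

end

subsection \<open>Smooth bump functions\<close>

text \<open>With \<open>p = 1\<close> and \<open>k = 0\<close> this is the standard smooth cutoff on
  \<open>{a<..<b}\<close>, which approaches the indicator as \<open>\<epsilon>\<close> tends to 0.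
  The rational prefactor makes the family closed under differentiation, so that smoothness follows
  by induction.\<close>

definition bump :: "real \<Rightarrow> real \<Rightarrow> real \<Rightarrow> real poly \<Rightarrow> nat \<Rightarrow> real \<Rightarrow> real" where
  "bump \<epsilon> a b p k x = (if a < x \<and> x < b
     then poly p x / ((x - a) * (b - x)) ^ k * exp (- (\<epsilon> / ((x - a) * (b - x)))) else 0)"

text \<open>The exponential beats the pole: \<open>exp (- (\<epsilon> / q))\<close> is at most a
  constant times any chosen power of \<open>q = (y - a) * (b - y)\<close>, and \<open>q\<close> is
  at most \<open>(b - a) * \<bar>y - x\<bar>\<close> for \<open>x\<close> outside the open interval.
  Quadratic vanishing makes the derivative at such \<open>x\<close>, endpoints included, equal to
  0.\<close>

lemma bump_quadratic_bound:
  assumes "\<epsilon> > 0" "a < b"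
  obtains C where "\<And>x y. x \<le> a \<or> b \<le> x \<Longrightarrow> \<bar>bump \<epsilon> a b p k y\<bar> \<le> C * (y - x)\<^sup>2"
proof -
  have "bounded (poly p ` {a..b})"
    by (intro compact_imp_bounded compact_continuous_image) (auto intro: continuous_intros)
  then obtain P where P: "\<And>y. y \<in> {a..b} \<Longrightarrow> \<bar>poly p y\<bar> \<le> P"
    unfolding bounded_iff by auto (metis atLeastAtMost_iff)
  then have "P \<ge> 0"
    using order_trans[OF abs_ge_zero P[of a]] \<open>a < b\<close> by auto
  \<comment> \<open>Of the \<open>n\<close> powers of \<open>q\<close>, \<open>k\<close> cancel the
    denominator and two remain for the quadratic bound.\<close>
  define n where "n = k + 2"
  define C where "C = P * (n / \<epsilon>) ^ n * (b - a)\<^sup>2"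
  have "C \<ge> 0"
    using \<open>P \<ge> 0\<close> \<open>\<epsilon> > 0\<close> by (simp add: C_def)
  have "\<bar>bump \<epsilon> a b p k y\<bar> \<le> C * (y - x)\<^sup>2" if x: "x \<le> a \<or> b \<le> x" for x y
  proof (cases "a < y \<and> y < b")
    case True
    define q where "q = (y - a) * (b - y)"
    have q: "q > 0" using True by (simp add: q_def)
    have "q \<le> (b - a) * \<bar>y - x\<bar>"
    proof (cases "x \<le> a")
      case True
      then have "q \<le> \<bar>y - x\<bar> * (b - a)"
        unfolding q_def using \<open>a < y \<and> y < b\<close> by (intro mult_mono) auto
      then show ?thesis by (simp add: mult.commute)
    next
      case False
      then show ?thesis
        unfolding q_def using \<open>a < y \<and> y < b\<close> x by (intro mult_mono) auto
    qed
    then have "q\<^sup>2 \<le> ((b - a) * \<bar>y - x\<bar>)\<^sup>2"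
      using q by (intro power_mono) auto
    then have q2: "q\<^sup>2 \<le> (b - a)\<^sup>2 * (y - x)\<^sup>2"
      by (simp add: power_mult_distrib)
    have qn: "q ^ n = q\<^sup>2 * q ^ k"
      unfolding n_def by (simp add: power2_eq_square)
    \<comment> \<open>The inequality \<open>z \<le> exp z\<close> at
      \<open>z = \<epsilon> / (q * n)\<close>, raised to the power \<open>n\<close>, bounds
      \<open>exp (\<epsilon> / q)\<close> from below by a power of \<open>1 / q\<close>.\<close>
    have "\<epsilon> / q / n \<le> exp (\<epsilon> / q / n)"
      using exp_ge_add_one_self[of "\<epsilon> / q / n"] by linarith
    then have "(\<epsilon> / q / n) ^ n \<le> exp (\<epsilon> / q / n) ^ n"
      using q \<open>\<epsilon> > 0\<close> by (intro power_mono) auto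
    also have "\<dots> = exp (real n * (\<epsilon> / q / n))"
      by (rule exp_of_nat_mult[symmetric])
    also have "real n * (\<epsilon> / q / n) = \<epsilon> / q"
      by (simp add: n_def)
    finally have "exp (- (\<epsilon> / q)) \<le> inverse ((\<epsilon> / q / n) ^ n)"
      unfolding exp_minus using q \<open>\<epsilon> > 0\<close>
      by (intro le_imp_inverse_le zero_less_power divide_pos_pos) (simp_all add: n_def)
    also have "\<dots> = (n / \<epsilon>) ^ n * q ^ n"
      by (simp add: power_divide inverse_eq_divide power_mult_distrib mult.commute)
    finally have "exp (- (\<epsilon> / q)) / q ^ k \<le> (n / \<epsilon>) ^ n * q\<^sup>2"
      unfolding pos_divide_le_eq[OF zero_less_power[OF q]] qn by (simp only: mult.assoc)
    then have "P * (exp (- (\<epsilon> / q)) / q ^ k) \<le> P * ((n / \<epsilon>) ^ n * ((b - a)\<^sup>2 * (y - x)\<^sup>2))"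
      using q2 \<open>P \<ge> 0\<close> \<open>\<epsilon> > 0\<close> by (intro mult_left_mono order_trans[OF _ mult_left_mono[OF q2]]) auto
    moreover have "\<bar>bump \<epsilon> a b p k y\<bar> = \<bar>poly p y\<bar> * (exp (- (\<epsilon> / q)) / q ^ k)"
      using True q by (simp add: bump_def q_def[symmetric] abs_mult power_abs)
    moreover have "\<bar>poly p y\<bar> * (exp (- (\<epsilon> / q)) / q ^ k) \<le> P * (exp (- (\<epsilon> / q)) / q ^ k)"
      using P[of y] True q by (intro mult_right_mono) auto
    ultimately show ?thesis
      by (simp add: C_def mult_ac)
  next
    case False
    then show ?thesis using \<open>C \<ge> 0\<close> by (auto simp: bump_def)
  qed
  then show ?thesis by (rule that)
qed

lemma bump_derivative:
  assumes "\<epsilon> > 0" "a < b"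
  obtains p' where "\<And>x. (bump \<epsilon> a b p k has_real_derivative bump \<epsilon> a b p' (k + 2) x) (at x)"
proof
  define Q where "Q = [:- a * b, a + b, - 1:]"
  \<comment> \<open>The three contributions over the common denominator \<open>Q ^ (k + 2)\<close>:
    the derivatives of \<open>p\<close>, of \<open>1 / Q ^ k\<close>, and of the exponential, whose
    logarithmic derivative is \<open>\<epsilon> * Q' / Q\<^sup>2\<close>.\<close>
  define p' where "p' = pderiv p * Q\<^sup>2 - of_nat k * p * pderiv Q * Q + [:\<epsilon>:] * p * pderiv Q"
  have Q: "poly Q x = (x - a) * (b - x)" "poly (pderiv Q) x = (b - x) - (x - a)" for x
    by (simp_all add: Q_def pderiv_pCons algebra_simps)
  show "(bump \<epsilon> a b p k has_real_derivative bump \<epsilon> a b p' (k + 2) x) (at x)" for x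
  proof (cases "a < x \<and> x < b")
    case True
    have q: "poly Q x > 0" using True by (simp add: Q)
    define r where "r = inverse (poly Q x)"
    define s where "s = poly (pderiv Q) x"
    have rq: "r * poly Q x = 1"
      using q by (simp add: r_def)
    have inv: "((\<lambda>x. inverse (poly Q x)) has_real_derivative - (r * s * r)) (at x)"
      unfolding r_def s_def using q by (intro DERIV_inverse' poly_DERIV) auto
    \<comment> \<open>For \<open>k = 0\<close> the exponent \<open>k - Suc 0\<close> is truncated to
      0, but then the factor \<open>of_nat k\<close> makes both sides vanish.\<close>
    have rk: "of_nat k * (- (r * s * r) * r ^ (k - Suc 0)) = - (of_nat k * s * r ^ (k + 1))"
      by (cases k) (simp_all add: mult_ac)
    have "((\<lambda>x. poly p x * inverse (poly Q x) ^ k * exp (- \<epsilon> * inverse (poly Q x))) has_real_derivative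
        (poly (pderiv p) x * r ^ k + of_nat k * (- (r * s * r) * r ^ (k - Suc 0)) * poly p x) * exp (- \<epsilon> * r)
        + exp (- \<epsilon> * r) * (- \<epsilon> * - (r * s * r)) * (poly p x * r ^ k)) (at x)"
      unfolding r_def
      by (intro DERIV_mult poly_DERIV DERIV_power DERIV_fun_exp DERIV_cmult inv[unfolded r_def])
    moreover have "(poly (pderiv p) x * r ^ k + of_nat k * (- (r * s * r) * r ^ (k - Suc 0)) * poly p x) * exp (- \<epsilon> * r)
        + exp (- \<epsilon> * r) * (- \<epsilon> * - (r * s * r)) * (poly p x * r ^ k) =
        (poly (pderiv p) x * (r * poly Q x)\<^sup>2 - of_nat k * poly p x * s * (r * poly Q x) * r + \<epsilon> * poly p x * s * r\<^sup>2)
          * r ^ k * exp (- \<epsilon> * r)"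
      unfolding rk rq by (simp add: algebra_simps power2_eq_square)
    moreover have "\<dots> = poly p' x * r ^ (k + 2) * exp (- \<epsilon> * r)"
      by (simp add: p'_def s_def algebra_simps power2_eq_square)
    moreover have "\<dots> = bump \<epsilon> a b p' (k + 2) x"
      using True unfolding bump_def Q(1)[symmetric] r_def by (simp add: divide_inverse power_inverse)
    ultimately have "((\<lambda>x. poly p x * inverse (poly Q x) ^ k * exp (- \<epsilon> * inverse (poly Q x)))
        has_real_derivative bump \<epsilon> a b p' (k + 2) x) (at x)"
      by (simp only:)
    then show ?thesis
      by (rule has_field_derivative_transform_within_open[of _ _ _ "{a<..<b}"])
        (use True in \<open>auto simp: bump_def Q divide_inverse power_inverse simp del: inverse_mult_distrib\<close>)
  next
    case False
    then have x: "x \<le> a \<or> b \<le> x" by auto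
    obtain C where C: "\<And>x y. x \<le> a \<or> b \<le> x \<Longrightarrow> \<bar>bump \<epsilon> a b p k y\<bar> \<le> C * (y - x)\<^sup>2"
      using bump_quadratic_bound[OF assms] by metis
    have zero: "bump \<epsilon> a b p'' k'' x = 0" for p'' k''
      using False by (auto simp: bump_def)
    have "((\<lambda>y. (bump \<epsilon> a b p k y - bump \<epsilon> a b p k x) / (y - x)) \<longlongrightarrow> 0) (at x)"
    proof (rule Lim_null_comparison[OF always_eventually])
      have "((\<lambda>y. C * \<bar>y - x\<bar>) \<longlongrightarrow> C * \<bar>x - x\<bar>) (at x)"
        by (intro tendsto_intros)
      then show "((\<lambda>y. C * \<bar>y - x\<bar>) \<longlongrightarrow> 0) (at x)" by simp
      show "\<forall>y. norm ((bump \<epsilon> a b p k y - bump \<epsilon> a b p k x) / (y - x)) \<le> C * \<bar>y - x\<bar>"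
      proof
        fix y
        show "norm ((bump \<epsilon> a b p k y - bump \<epsilon> a b p k x) / (y - x)) \<le> C * \<bar>y - x\<bar>"
          using C[OF x, of y] by (cases "y = x")
            (simp_all add: zero divide_le_eq power2_eq_square abs_mult mult.assoc)
      qed
    qed
    then show ?thesis
      by (simp add: has_field_derivative_iff zero)
  qed
qed

lemma test_function_bump:
  assumes "\<epsilon> > 0" "a < b"
  shows "test_function (bump \<epsilon> a b p k)"
proof -
  have "\<exists>p' k'. (deriv ^^ n) (bump \<epsilon> a b p k) = bump \<epsilon> a b p' k'" for n
  proof (induction n)
    case (Suc n)
    then obtain p' k' where IH: "(deriv ^^ n) (bump \<epsilon> a b p k) = bump \<epsilon> a b p' k'" by blast
    obtain p'' where "\<And>x. (bump \<epsilon> a b p' k' has_real_derivative bump \<epsilon> a b p'' (k' + 2) x) (at x)"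
      using bump_derivative[OF assms] by metis
    then have "deriv (bump \<epsilon> a b p' k') = bump \<epsilon> a b p'' (k' + 2)"
      by (auto intro: DERIV_imp_deriv)
    then show ?case using IH by auto
  qed auto
  moreover have "bump \<epsilon> a b p' k' differentiable at x" for p' k' x
    using bump_derivative[OF assms, of p' k'] by (metis real_differentiable_def)
  ultimately have "(deriv ^^ n) (bump \<epsilon> a b p k) differentiable at x" for n x
    by metis
  moreover have "bounded {x. bump \<epsilon> a b p k x \<noteq> 0}"
    by (rule bounded_subset[of "{a..b}"]) (auto simp: bump_def split: if_splits)
  ultimately show ?thesis
    by (auto simp: test_function_def)
qed

text \<open>This turns equality against test functions into equality of integrals over intervals.
  The cutoffs are bounded by 1 and tend to 1 at each interior point; their limit differs from the
  indicator of \<open>{a..b}\<close> at the two endpoints only.\<close>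

lemma test_function_approximates_interval:
  fixes f :: "real \<Rightarrow> complex"
  assumes f: "set_integrable lborel {a..b} f" and "a < b"
  shows "(\<lambda>n. LINT x|lborel. bump (1 / Suc n) a b 1 0 x *\<^sub>R f x) \<longlonglongrightarrow> (LINT x:{a..b}|lborel. f x)"
proof -
  define F where "F x = indicat_real {a..b} x *\<^sub>R f x" for x
  have F: "integrable lborel F"
    using f by (simp add: F_def[abs_def] set_integrable_def)
  note [measurable] = borel_measurable_integrable[OF F]
  have "bump (1 / Suc n) a b 1 0 x *\<^sub>R f x = bump (1 / Suc n) a b 1 0 x *\<^sub>R F x" for n x
    by (simp add: bump_def F_def)
  moreover have "(\<lambda>n. LINT x|lborel. bump (1 / Suc n) a b 1 0 x *\<^sub>R F x) \<longlonglongrightarrow> integral\<^sup>L lborel F"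
  proof (rule integral_dominated_convergence[where w = "\<lambda>x. cmod (F x)"])
    show "(\<lambda>x. bump (1 / Suc n) a b 1 0 x *\<^sub>R F x) \<in> borel_measurable lborel" for n
      unfolding bump_def poly_1 by measurable
    show "AE x in lborel. (\<lambda>n. bump (1 / Suc n) a b 1 0 x *\<^sub>R F x) \<longlonglongrightarrow> F x"
      using AE_lborel_singleton[of a] AE_lborel_singleton[of b]
    proof eventually_elim
      case (elim x)
      show ?case
      proof (cases "a < x \<and> x < b")
        case True
        have "(\<lambda>n. exp (- (inverse (real (Suc n)) / ((x - a) * (b - x)))) *\<^sub>R F x) \<longlonglongrightarrow>
            exp (- (0 / ((x - a) * (b - x)))) *\<^sub>R F x"
          using True by (intro tendsto_intros LIMSEQ_inverse_real_of_nat) auto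
        then show ?thesis
          using True by (simp add: bump_def inverse_eq_divide)
      qed (use elim in \<open>auto simp: F_def\<close>)
    qed
    show "AE x in lborel. norm (bump (1 / Suc n) a b 1 0 x *\<^sub>R F x) \<le> cmod (F x)" for n
      by (intro AE_I2) (auto simp: bump_def intro!: mult_left_le_one_le)
  qed (use F in auto)
  ultimately show ?thesis
    unfolding set_lebesgue_integral_def F_def[symmetric] by (simp only:)
qed

subsection \<open>Mean-square limits of Fourier transforms\<close>

text \<open>Completeness of the space of square-integrable functions, with the rate kept. Along a
  subsequence with errors at most \<open>(1 / 8) ^ k\<close>, the series of
  \<open>4 ^ k * (d k x)\<^sup>2\<close> has a finite integral; so almost everywhere
  \<open>d k x\<close> is at most a multiple of \<open>(1 / 2) ^ k\<close>, and the subsequence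
  converges. Fatou's lemma carries the bound \<open>T n\<close> over to the limit.\<close>

lemma L2_limit:
  fixes f :: "nat \<Rightarrow> 'a \<Rightarrow> complex" and T :: "nat \<Rightarrow> real"
  assumes [measurable]: "\<And>n. f n \<in> borel_measurable M"
    and cauchy: "\<And>m n. n \<le> m \<Longrightarrow> (\<integral>\<^sup>+x. ennreal ((cmod (f m x - f n x))\<^sup>2) \<partial>M) \<le> ennreal (T n)"
    and T: "T \<longlonglongrightarrow> 0"
  obtains g where "g \<in> borel_measurable M"
    "\<And>n. (\<integral>\<^sup>+x. ennreal ((cmod (g x - f n x))\<^sup>2) \<partial>M) \<le> ennreal (T n)"
proof -
  have "\<exists>N. \<forall>n\<ge>N. T n \<le> (1 / 8) ^ k" for k
    using order_tendstoD(2)[OF T, of "(1/8)^k"] by (auto simp: eventually_sequentially intro: less_imp_le)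
  then obtain N where N: "\<And>k n. N k \<le> n \<Longrightarrow> T n \<le> (1 / 8) ^ k" by metis
  \<comment> \<open>Partial sums of the thresholds make \<open>r\<close> nondecreasing with
    \<open>N k \<le> r k\<close>; the summand \<open>k\<close> makes it unbounded, so that it
    eventually exceeds any given \<open>n\<close> in the application of Fatou's lemma.\<close>
  define r where "r k = (\<Sum>j\<le>k. N j) + k" for k
  have rN: "N k \<le> r k" and r_ge: "k \<le> r k" and r_Suc: "r k \<le> r (Suc k)" for k
    using member_le_sum[of k "{..k}" N] by (simp_all add: r_def)
  define d where "d k x = cmod (f (r (Suc k)) x - f (r k) x)" for k x
  have [measurable]: "d k \<in> borel_measurable M" for k
    unfolding d_def by measurable
  have "(\<integral>\<^sup>+x. (\<Sum>k. ennreal (4 ^ k) * ennreal ((d k x)\<^sup>2)) \<partial>M) =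
      (\<Sum>k. \<integral>\<^sup>+x. ennreal (4 ^ k) * ennreal ((d k x)\<^sup>2) \<partial>M)"
    by (rule nn_integral_suminf) measurable
  also have "\<dots> \<le> (\<Sum>k. ennreal ((1 / 2) ^ k))"
  proof (intro suminf_le)
    fix k
    have "(\<integral>\<^sup>+x. ennreal (4 ^ k) * ennreal ((d k x)\<^sup>2) \<partial>M) = ennreal (4 ^ k) * (\<integral>\<^sup>+x. ennreal ((d k x)\<^sup>2) \<partial>M)"
      by (rule nn_integral_cmult) measurable
    also have "\<dots> \<le> ennreal (4 ^ k) * ennreal ((1 / 8) ^ k)"
      unfolding d_def by (intro mult_left_mono order_trans[OF cauchy[OF r_Suc]] ennreal_leI N rN) auto
    also have "\<dots> = ennreal ((1 / 2) ^ k)"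
      by (simp flip: ennreal_mult power_mult_distrib)
    finally show "(\<integral>\<^sup>+x. ennreal (4 ^ k) * ennreal ((d k x)\<^sup>2) \<partial>M) \<le> ennreal ((1 / 2) ^ k)" .
  qed auto
  also have "\<dots> = ennreal (\<Sum>k. (1 / 2) ^ k)"
    by (intro suminf_ennreal2 summable_geometric) auto
  finally have "(\<integral>\<^sup>+x. (\<Sum>k. ennreal (4 ^ k) * ennreal ((d k x)\<^sup>2)) \<partial>M) \<noteq> \<infinity>"
    by (auto simp: top_unique)
  then have "AE x in M. (\<Sum>k. ennreal (4 ^ k) * ennreal ((d k x)\<^sup>2)) \<noteq> \<infinity>"
    by (intro nn_integral_PInf_AE) auto
  then have conv: "AE x in M. convergent (\<lambda>k. f (r k) x)"
  proof eventually_elim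
    case (elim x)
    then obtain C where C: "C \<ge> 0" "(\<Sum>k. ennreal (4 ^ k) * ennreal ((d k x)\<^sup>2)) = ennreal C"
      by (cases "\<Sum>k. ennreal (4 ^ k) * ennreal ((d k x)\<^sup>2)") auto
    have four: "(2 ^ k)\<^sup>2 = (4 :: real) ^ k" for k
      using power_mult_distrib[of "2 :: real" 2 k] by (simp add: power2_eq_square)
    have "d k x \<le> sqrt C * (1 / 2) ^ k" for k
    proof -
      have "(\<Sum>j\<in>{k}. ennreal (4 ^ j) * ennreal ((d j x)\<^sup>2)) \<le> ennreal C"
        unfolding C(2)[symmetric] by (intro sum_le_suminf) auto
      then have "4 ^ k * (d k x)\<^sup>2 \<le> C"
        using C(1) by (simp flip: ennreal_mult)
      then have "(2 ^ k * d k x)\<^sup>2 \<le> C"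
        unfolding power_mult_distrib four .
      then have "2 ^ k * d k x \<le> sqrt C"
        by (rule real_le_rsqrt)
      then show ?thesis
        by (simp add: power_one_over field_simps)
    qed
    then have le: "cmod (f (r (Suc k)) x - f (r k) x) \<le> sqrt C * (1 / 2) ^ k" for k
      by (simp only: d_def)
    have "summable (\<lambda>k. f (r (Suc k)) x - f (r k) x)"
    proof (rule summable_comparison_test')
      show "summable (\<lambda>k. sqrt C * (1 / 2) ^ k)"
        by (intro summable_mult summable_geometric) simp
      show "cmod (f (r (Suc k)) x - f (r k) x) \<le> sqrt C * (1 / 2) ^ k" if "k \<ge> 0" for k
        by (rule le)
    qed
    then have "convergent (\<lambda>n. \<Sum>k<n. f (r (Suc k)) x - f (r k) x)"
      by (simp add: summable_iff_convergent)
    then have "convergent (\<lambda>n. f (r n) x - f (r 0) x)"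
      by (simp only: sum_lessThan_telescope[of "\<lambda>k. f (r k) x"])
    from convergent_add[OF this convergent_const[of "f (r 0) x"]] show ?case
      by simp
  qed
  define g where "g x = lim (\<lambda>k. f (r k) x)" for x
  have [measurable]: "g \<in> borel_measurable M"
    unfolding g_def by measurable
  have "(\<integral>\<^sup>+x. ennreal ((cmod (g x - f n x))\<^sup>2) \<partial>M) \<le> ennreal (T n)" for n
  proof -
    have "(\<integral>\<^sup>+x. ennreal ((cmod (g x - f n x))\<^sup>2) \<partial>M) =
        (\<integral>\<^sup>+x. liminf (\<lambda>k. ennreal ((cmod (f (r k) x - f n x))\<^sup>2)) \<partial>M)"
    proof (rule nn_integral_cong_AE)
      show "AE x in M. ennreal ((cmod (g x - f n x))\<^sup>2) = liminf (\<lambda>k. ennreal ((cmod (f (r k) x - f n x))\<^sup>2))"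
        using conv
      proof eventually_elim
        case (elim x)
        then have "(\<lambda>k. f (r k) x) \<longlonglongrightarrow> g x"
          by (simp add: g_def convergent_LIMSEQ_iff)
        then have "(\<lambda>k. ennreal ((cmod (f (r k) x - f n x))\<^sup>2)) \<longlonglongrightarrow> ennreal ((cmod (g x - f n x))\<^sup>2)"
          by (intro tendsto_ennrealI tendsto_intros)
        then show ?case
          by (intro lim_imp_Liminf[symmetric]) auto
      qed
    qed
    also have "\<dots> \<le> liminf (\<lambda>k. \<integral>\<^sup>+x. ennreal ((cmod (f (r k) x - f n x))\<^sup>2) \<partial>M)"
      by (rule nn_integral_liminf) measurable
    also have "\<dots> \<le> ennreal (T n)"
    proof (intro Liminf_le)
      show "\<forall>\<^sub>F k in sequentially. (\<integral>\<^sup>+x. ennreal ((cmod (f (r k) x - f n x))\<^sup>2) \<partial>M) \<le> ennreal (T n)"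
        using eventually_ge_at_top[of n]
        by eventually_elim (intro cauchy order_trans[OF _ r_ge])
    qed simp
    finally show ?thesis .
  qed
  then show ?thesis
    using \<open>g \<in> borel_measurable M\<close> that by blast
qed

lemma integrable_square_diff:
  fixes f g :: "'a \<Rightarrow> complex"
  assumes [measurable]: "f \<in> borel_measurable M" "g \<in> borel_measurable M"
    and fg: "(\<integral>\<^sup>+x. ennreal ((cmod (f x - g x))\<^sup>2) \<partial>M) < \<infinity>"
    and g: "integrable M (\<lambda>x. (cmod (g x))\<^sup>2)"
  shows "integrable M (\<lambda>x. (cmod (f x))\<^sup>2)"
proof (rule Bochner_Integration.integrable_bound)
  have "integrable M (\<lambda>x. (cmod (f x - g x))\<^sup>2)"
    using fg by (intro integrableI_nonneg) auto
  then show "integrable M (\<lambda>x. 2 * (cmod (f x - g x))\<^sup>2 + 2 * (cmod (g x))\<^sup>2)"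
    using g by simp
  have "(cmod (f x))\<^sup>2 \<le> 2 * (cmod (f x - g x))\<^sup>2 + 2 * (cmod (g x))\<^sup>2" for x
  proof -
    have "(cmod (f x))\<^sup>2 \<le> (cmod (f x - g x) + cmod (g x))\<^sup>2"
      using norm_triangle_ineq[of "f x - g x" "g x"] by (intro power_mono) auto
    also have "\<dots> \<le> 2 * (cmod (f x - g x))\<^sup>2 + 2 * (cmod (g x))\<^sup>2"
      using sum_squares_bound[of "cmod (f x - g x)" "cmod (g x)"] by (simp add: power2_sum)
    finally show ?thesis .
  qed
  then show "AE x in M. norm ((cmod (f x))\<^sup>2) \<le> norm (2 * (cmod (f x - g x))\<^sup>2 + 2 * (cmod (g x))\<^sup>2)"
    by (intro AE_I2) simp
qed measurable

section \<open>Weighted square integrability and transforms of truncations\<close>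

lemma integrable_inverse_one_plus_square: "integrable lborel (\<lambda>x :: real. 1 / (1 + x\<^sup>2))"
  using integrable_inverse_1_plus_square
  by (simp add: set_integrable_def einterval_eq inverse_eq_divide)

text \<open>A pointwise form of Cauchy-Schwarz: \<open>2 * z \<le> 1 / s + s * z\<^sup>2\<close>
  with the weight \<open>s = 1 + x\<^sup>2\<close>, whose reciprocal is integrable and for which
  \<open>s * z\<^sup>2\<close> is the sum of the two given squares.\<close>

lemma integrable_weighted_L2:
  fixes v :: "real \<Rightarrow> complex"
  assumes [measurable]: "v \<in> borel_measurable lborel"
    and v: "integrable lborel (\<lambda>x. (cmod (v x))\<^sup>2)"
    and xv: "integrable lborel (\<lambda>x. (cmod (of_real x * v x))\<^sup>2)"
  shows "integrable lborel v"
proof (rule Bochner_Integration.integrable_bound)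
  show "integrable lborel (\<lambda>x. 1 / (1 + x\<^sup>2) + ((cmod (v x))\<^sup>2 + (cmod (of_real x * v x))\<^sup>2))"
    using v xv integrable_inverse_one_plus_square by simp
  have "cmod (v x) \<le> 1 / (1 + x\<^sup>2) + ((cmod (v x))\<^sup>2 + (cmod (of_real x * v x))\<^sup>2)" for x
  proof -
    define s where "s = 1 + x\<^sup>2"
    have s: "s > 0" by (simp add: s_def add_pos_nonneg)
    have "0 \<le> (1 - s * cmod (v x))\<^sup>2 / s"
      using s by simp
    also have "(1 - s * cmod (v x))\<^sup>2 / s = 1 / s + s * (cmod (v x))\<^sup>2 - 2 * cmod (v x)"
      using s by (simp add: power2_eq_square field_simps)
    finally have "2 * cmod (v x) \<le> 1 / s + s * (cmod (v x))\<^sup>2" by simp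
    moreover have "s * (cmod (v x))\<^sup>2 = (cmod (v x))\<^sup>2 + (cmod (of_real x * v x))\<^sup>2"
      by (simp add: s_def norm_mult power_mult_distrib algebra_simps)
    ultimately show ?thesis
      using norm_ge_zero[of "v x"] by (simp add: s_def del: norm_ge_zero)
  qed
  then show "AE x in lborel. cmod (v x) \<le> norm (1 / (1 + x\<^sup>2) + ((cmod (v x))\<^sup>2 + (cmod (of_real x * v x))\<^sup>2))"
    by (intro AE_I2) (smt (verit) real_norm_def)
qed measurable

lemma fourier_diff:
  assumes "integrable lborel v" "integrable lborel w"
  shows "fourier v \<xi> - fourier w \<xi> = fourier (\<lambda>x. v x - w x) \<xi>"
  using integrable_fourier[OF assms(1), of \<xi>] integrable_fourier[OF assms(2), of \<xi>]
  by (simp add: fourier_def right_diff_distrib[symmetric] left_diff_distrib Bochner_Integration.integral_diff)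

lemma fourier_bounded:
  "cmod (fourier v \<xi>) \<le> (2 * pi) powr (-1/2) * (\<integral>x. cmod (v x) \<partial>lborel)"
proof -
  have "cmod (\<integral>x. v x * exp (- (\<i> * of_real (x * \<xi>))) \<partial>lborel) \<le> (\<integral>x. cmod (v x * exp (- (\<i> * of_real (x * \<xi>)))) \<partial>lborel)"
    by (rule integral_norm_bound)
  then show ?thesis
    by (simp add: fourier_def norm_mult mult_left_mono)
qed

lemma measurable_fourier:
  "integrable lborel v \<Longrightarrow> fourier v \<in> borel_measurable lborel"
  using borel_measurable_continuous_onI[OF continuous_fourier] by simp

lemma fourier_square_integrable:
  assumes "integrable lborel v" "integrable lborel (\<lambda>x. (cmod (v x))\<^sup>2)"
  shows "integrable lborel (\<lambda>\<xi>. (cmod (fourier v \<xi>))\<^sup>2)"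
proof (rule integrableI_nonneg)
  have "(\<integral>\<^sup>+\<xi>. ennreal ((cmod (fourier v \<xi>))\<^sup>2) \<partial>lborel) \<le> (\<integral>\<^sup>+x. ennreal ((cmod (v x))\<^sup>2) \<partial>lborel)"
    by (rule fourier_square_norm_le[OF assms(1)])
  also have "\<dots> = ennreal (\<integral>x. (cmod (v x))\<^sup>2 \<partial>lborel)"
    by (rule nn_integral_eq_integral[OF assms(2)]) simp
  also have "\<dots> < \<infinity>"
    by simp
  finally show "(\<integral>\<^sup>+\<xi>. ennreal ((cmod (fourier v \<xi>))\<^sup>2) \<partial>lborel) < \<infinity>" .
qed (use measurable_fourier[OF assms(1)] in auto)

lemma tail_tendsto_zero:
  fixes f :: "real \<Rightarrow> real"
  assumes "integrable lborel f"
  shows "((\<lambda>R. \<integral>x. indicator (- {-R..R}) x * f x \<partial>lborel) \<longlongrightarrow> 0) at_top"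
proof -
  have "((\<lambda>R. \<integral>x. indicator (- {-R..R}) x * f x \<partial>lborel) \<longlongrightarrow> integral\<^sup>L lborel (\<lambda>x :: real. 0)) at_top"
  proof (rule integral_dominated_convergence_at_top[where w = "\<lambda>x. norm (f x)"])
    show "AE x in lborel. ((\<lambda>R. indicator (- {-R..R}) x * f x) \<longlongrightarrow> 0) at_top"
    proof (intro AE_I2 tendsto_eventually)
      show "\<forall>\<^sub>F R in at_top. indicator (- {-R..R}) x * f x = 0" for x
        using eventually_ge_at_top[of "\<bar>x\<bar>"] by eventually_elim (auto simp: indicator_def)
    qed
    show "\<forall>\<^sub>F R in at_top. AE x in lborel. norm (indicator (- {-R..R}) x * f x) \<le> norm (f x)"
      by (intro always_eventually allI AE_I2) (simp add: indicator_def)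
  qed (use assms in auto)
  then show ?thesis by simp
qed

lemma integrable_indicator_Icc:
  fixes a b :: real
  shows "integrable lborel (indicat_real {a..b})"
  by (intro integrable_real_indicator) (simp_all add: emeasure_lborel_Icc_eq)

lemma square_integrable_imp_set_integrable_Icc:
  fixes g :: "real \<Rightarrow> complex"
  assumes [measurable]: "g \<in> borel_measurable lborel" and g: "integrable lborel (\<lambda>x. (cmod (g x))\<^sup>2)"
  shows "set_integrable lborel {a..b} g"
  unfolding set_integrable_def
proof (rule Bochner_Integration.integrable_bound)
  show "integrable lborel (\<lambda>x. indicator {a..b} x + (cmod (g x))\<^sup>2)"
    using g by (intro Bochner_Integration.integrable_add integrable_indicator_Icc)
  have "cmod (g x) \<le> 1 + (cmod (g x))\<^sup>2" for x
    using sum_squares_bound[of 1 "cmod (g x)"] by (simp add: algebra_simps) (smt (verit) norm_ge_zero)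
  then show "AE x in lborel. norm (indicator {a..b} x *\<^sub>R g x) \<le> norm (indicator {a..b} x + (cmod (g x))\<^sup>2)"
    by (intro AE_I2) (auto simp: indicator_def)
qed measurable

text \<open>By linearity the error is the transform of the part of \<open>v\<close> outside
  \<open>{-R..R}\<close>. The Plancherel inequality bounds it by a tail that vanishes as
  \<open>R\<close> grows, which is how \<open>fourier v\<close> becomes the mean-square limit in the
  definition.\<close>

lemma fourier_truncation_error:
  fixes v :: "real \<Rightarrow> complex"
  assumes v: "integrable lborel v" and v2: "integrable lborel (\<lambda>x. (cmod (v x))\<^sup>2)"
  shows "(\<integral>\<^sup>+\<xi>. ennreal ((cmod (fourier (\<lambda>x. indicator {-R..R} x *\<^sub>R v x) \<xi> - fourier v \<xi>))\<^sup>2) \<partial>lborel)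
    \<le> ennreal (\<integral>x. indicator (- {-R..R}) x * (cmod (v x))\<^sup>2 \<partial>lborel)"
proof -
  have vR: "integrable lborel (\<lambda>x. indicator {-R..R} x *\<^sub>R v x)"
    using v by (intro integrable_mult_indicator) auto
  have v2R: "integrable lborel (\<lambda>x. indicator (- {-R..R}) x * (cmod (v x))\<^sup>2)"
    using integrable_mult_indicator[OF _ v2, of "- {-R..R}"] by simp
  have "(\<integral>\<^sup>+\<xi>. ennreal ((cmod (fourier (\<lambda>x. indicator {-R..R} x *\<^sub>R v x) \<xi> - fourier v \<xi>))\<^sup>2) \<partial>lborel) \<le>
      (\<integral>\<^sup>+x. ennreal ((cmod (indicator {-R..R} x *\<^sub>R v x - v x))\<^sup>2) \<partial>lborel)"
    unfolding fourier_diff[OF vR v] by (intro fourier_square_norm_le Bochner_Integration.integrable_diff vR v)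
  also have "\<dots> = (\<integral>\<^sup>+x. ennreal (indicator (- {-R..R}) x * (cmod (v x))\<^sup>2) \<partial>lborel)"
    by (intro nn_integral_cong) (auto simp: indicator_def)
  also have "\<dots> = ennreal (\<integral>x. indicator (- {-R..R}) x * (cmod (v x))\<^sup>2 \<partial>lborel)"
    by (intro nn_integral_eq_integral v2R AE_I2) (simp add: indicator_def)
  finally show ?thesis .
qed

text \<open>The character has \<open>\<xi>\<close>-derivative \<open>- \<i> * x\<close> times
  itself. Integrating this over \<open>{a..b}\<close> and exchanging the integrals is legitimate
  when \<open>x * p\<close> is integrable, as it is for truncated functions.\<close>

lemma fourier_increment:
  fixes p :: "real \<Rightarrow> complex"
  assumes p: "integrable lborel p" and xp: "integrable lborel (\<lambda>x. - \<i> * of_real x * p x)" and ab: "a \<le> b"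
  shows "fourier p b - fourier p a = (LINT \<xi>:{a..b}|lborel. fourier (\<lambda>x. - \<i> * of_real x * p x) \<xi>)"
proof -
  define c where "c = complex_of_real ((2 * pi) powr (-1/2))"
  define e where "e x \<xi> = exp (- (\<i> * complex_of_real (x * \<xi>)))" for x \<xi>
  have FTC: "- \<i> * of_real x * (\<integral>\<xi>. indicator {a..b} \<xi> *\<^sub>R e x \<xi> \<partial>lborel) = e x b - e x a" for x
  proof -
    have "(\<integral>\<xi>. indicator {a..b} \<xi> *\<^sub>R (- \<i> * of_real x * e x \<xi>) \<partial>lborel) = e x b - e x a"
    proof (rule integral_FTC_atLeastAtMost[OF ab])
      show "continuous_on {a..b} (\<lambda>\<xi>. - \<i> * of_real x * e x \<xi>)"
        unfolding e_def by (intro continuous_intros)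
      show "(e x has_vector_derivative - \<i> * of_real x * e x \<xi>) (at \<xi> within {a..b})" for \<xi>
        unfolding e_def
        by (rule has_vector_derivative_eq_rhs, (rule derivative_eq_intros has_vector_derivative_real_field refl | simp)+)
    qed
    moreover have "(\<integral>\<xi>. indicator {a..b} \<xi> *\<^sub>R (- \<i> * of_real x * e x \<xi>) \<partial>lborel) =
        (\<integral>\<xi>. - \<i> * of_real x * (indicator {a..b} \<xi> *\<^sub>R e x \<xi>) \<partial>lborel)"
      by simp
    ultimately show ?thesis
      by (simp only: integral_mult_right_zero)
  qed
  have "(LINT \<xi>:{a..b}|lborel. fourier (\<lambda>x. - \<i> * of_real x * p x) \<xi>) =
      c * (\<integral>\<xi>. of_real (indicator {a..b} \<xi>) * (\<integral>x. - \<i> * of_real x * p x * e x \<xi> \<partial>lborel) \<partial>lborel)"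
    unfolding set_lebesgue_integral_def fourier_def c_def[symmetric] e_def[symmetric] scaleR_conv_of_real
    by (subst integral_mult_right_zero[symmetric]) (simp only: mult_ac)
  also have "(\<integral>\<xi>. of_real (indicator {a..b} \<xi>) * (\<integral>x. - \<i> * of_real x * p x * e x \<xi> \<partial>lborel) \<partial>lborel) =
      (\<integral>x. - \<i> * of_real x * p x * (\<integral>\<xi>. of_real (indicator {a..b} \<xi>) * e x \<xi> \<partial>lborel) \<partial>lborel)"
  proof (intro integral_kernel_swap xp)
    show "integrable lborel (\<lambda>\<xi>. complex_of_real (indicator {a..b} \<xi>))"
      by (intro integrable_of_real integrable_indicator_Icc)
    show "(\<lambda>(\<xi>, x). e x \<xi>) \<in> borel_measurable (lborel \<Otimes>\<^sub>M lborel)"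
      unfolding e_def split_beta' by measurable
  qed (simp add: e_def)
  also have "(\<lambda>x. - \<i> * of_real x * p x * (\<integral>\<xi>. of_real (indicator {a..b} \<xi>) * e x \<xi> \<partial>lborel)) =
      (\<lambda>x. p x * e x b - p x * e x a)"
  proof
    fix x
    have "- \<i> * of_real x * p x * (\<integral>\<xi>. of_real (indicator {a..b} \<xi>) * e x \<xi> \<partial>lborel) =
        p x * (- \<i> * of_real x * (\<integral>\<xi>. indicator {a..b} \<xi> *\<^sub>R e x \<xi> \<partial>lborel))"
      by (simp add: scaleR_conv_of_real)
    then show "- \<i> * of_real x * p x * (\<integral>\<xi>. of_real (indicator {a..b} \<xi>) * e x \<xi> \<partial>lborel) = p x * e x b - p x * e x a"
      unfolding FTC by (simp only: right_diff_distrib)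
  qed
  also have "(\<integral>x. p x * e x b - p x * e x a \<partial>lborel) = (\<integral>x. p x * e x b \<partial>lborel) - (\<integral>x. p x * e x a \<partial>lborel)"
    unfolding e_def by (intro Bochner_Integration.integral_diff integrable_fourier p)
  finally show ?thesis
    by (simp only: fourier_def c_def e_def right_diff_distrib)
qed

text \<open>The inequality \<open>z \<le> \<delta> + z\<^sup>2 / \<delta>\<close>, integrated over
  the bounded interval with \<open>\<delta>\<close> comparable to the mean-square error, plays the
  part of Cauchy-Schwarz.\<close>

lemma set_integral_L2_tendsto:
  fixes f :: "nat \<Rightarrow> real \<Rightarrow> complex" and g :: "real \<Rightarrow> complex"
  assumes f: "\<And>n. set_integrable lborel {a..b} (f n)" and g: "set_integrable lborel {a..b} g"
    and [measurable]: "\<And>n. f n \<in> borel_measurable lborel" "g \<in> borel_measurable lborel"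
    and fg: "\<And>n. (\<integral>\<^sup>+x. ennreal ((cmod (g x - f n x))\<^sup>2) \<partial>lborel) \<le> ennreal (T n)"
    and T: "T \<longlonglongrightarrow> 0" "\<And>n. 0 \<le> T n" and ab: "a \<le> b"
  shows "(\<lambda>n. LINT x:{a..b}|lborel. f n x) \<longlonglongrightarrow> (LINT x:{a..b}|lborel. g x)"
proof -
  \<comment> \<open>The summand \<open>inverse (real (Suc n))\<close> keeps
    \<open>\<delta> n\<close> positive, hence fit for division, even when \<open>T n\<close> is
    0.\<close>
  define \<delta> where "\<delta> n = sqrt (T n + inverse (real (Suc n)))" for n
  have \<delta>: "\<delta> n > 0" "T n \<le> (\<delta> n)\<^sup>2" for n
    using T(2)[of n] by (auto simp: \<delta>_def intro!: add_nonneg_pos)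
  have \<delta>0: "\<delta> \<longlonglongrightarrow> sqrt (0 + 0)"
    unfolding \<delta>_def by (intro tendsto_intros T LIMSEQ_inverse_real_of_nat)
  have "cmod ((LINT x:{a..b}|lborel. f n x) - (LINT x:{a..b}|lborel. g x)) \<le> \<delta> n * (b - a + 1)" for n
  proof -
    have sq: "integrable lborel (\<lambda>x. (cmod (g x - f n x))\<^sup>2)"
      using fg[of n] by (intro integrableI_nonneg) (auto intro: le_less_trans)
    have i: "integrable lborel (\<lambda>x. indicat_real {a..b} x * \<delta> n)"
      "integrable lborel (\<lambda>x. (cmod (g x - f n x))\<^sup>2 / \<delta> n)"
      using sq by (auto intro!: integrable_mult_left integrable_indicator_Icc)
    have sq_le: "(\<integral>x. (cmod (g x - f n x))\<^sup>2 \<partial>lborel) \<le> T n"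
    proof -
      have "ennreal (\<integral>x. (cmod (g x - f n x))\<^sup>2 \<partial>lborel) \<le> ennreal (T n)"
        using fg[of n] by (subst nn_integral_eq_integral[symmetric, OF sq]) auto
      then show ?thesis using T(2)[of n] by simp
    qed
    have "cmod ((LINT x:{a..b}|lborel. f n x) - (LINT x:{a..b}|lborel. g x)) =
        cmod (LINT x:{a..b}|lborel. g x - f n x)"
      using f g by (simp add: set_integral_diff norm_minus_commute)
    also have "\<dots> \<le> (LINT x:{a..b}|lborel. cmod (g x - f n x))"
      using f g by (intro set_integral_norm_bound set_integral_diff)
    also have "\<dots> \<le> (\<integral>x. indicator {a..b} x * \<delta> n + (cmod (g x - f n x))\<^sup>2 / \<delta> n \<partial>lborel)"
      unfolding set_lebesgue_integral_def
    proof (rule integral_mono)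
      show "integrable lborel (\<lambda>x. indicat_real {a..b} x *\<^sub>R cmod (g x - f n x))"
        using set_integrable_norm[OF set_integral_diff(1)[OF g f[of n]]] by (simp add: set_integrable_def)
      show "integrable lborel (\<lambda>x. indicator {a..b} x * \<delta> n + (cmod (g x - f n x))\<^sup>2 / \<delta> n)"
        by (intro Bochner_Integration.integrable_add i)
      fix x
      have "z \<le> \<delta> n + z\<^sup>2 / \<delta> n" if "z \<ge> 0" for z
      proof (cases "z \<le> \<delta> n")
        case True
        then show ?thesis using \<delta>(1)[of n] by (intro order_trans[OF True]) simp
      next
        case False
        then have "z * \<delta> n \<le> z * z" using that by (intro mult_left_mono) auto
        then have "z \<le> z\<^sup>2 / \<delta> n" using \<delta>(1)[of n] by (simp add: pos_le_divide_eq power2_eq_square)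
        then show ?thesis using \<delta>(1)[of n] by simp
      qed
      then show "indicat_real {a..b} x *\<^sub>R cmod (g x - f n x) \<le>
          indicator {a..b} x * \<delta> n + (cmod (g x - f n x))\<^sup>2 / \<delta> n"
        using \<delta>(1)[of n] by (auto simp: indicator_def intro: divide_nonneg_pos)
    qed
    also have "\<dots> = (b - a) * \<delta> n + (\<integral>x. (cmod (g x - f n x))\<^sup>2 \<partial>lborel) / \<delta> n"
      unfolding Bochner_Integration.integral_add[OF i] using ab by simp
    also have "\<dots> \<le> (b - a) * \<delta> n + (\<delta> n)\<^sup>2 / \<delta> n"
      using \<delta>[of n] sq_le by (intro add_left_mono divide_right_mono) auto
    also have "\<dots> = \<delta> n * (b - a + 1)"
      using \<delta>(1)[of n] by (simp add: power2_eq_square algebra_simps)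
    finally show ?thesis .
  qed
  note bound = this
  have "(\<lambda>n. \<delta> n * (b - a + 1)) \<longlonglongrightarrow> sqrt (0 + 0) * (b - a + 1)"
    by (intro tendsto_mult \<delta>0 tendsto_const)
  then have "(\<lambda>n. \<delta> n * (b - a + 1)) \<longlonglongrightarrow> 0"
    by simp
  then show ?thesis
    by (rule LIM_zero_cancel[OF Lim_null_comparison[OF always_eventually[OF allI[OF bound]]]])
qed

text \<open>The antiderivative property survives the mean-square limit of the truncations of
  \<open>- \<i> x v\<close>, which need not be integrable.\<close>

lemma fourier_indefinite_integral:
  fixes v :: "real \<Rightarrow> complex"
  assumes vm [measurable]: "v \<in> borel_measurable lborel"
    and v2: "integrable lborel (\<lambda>x. (cmod (v x))\<^sup>2)"
    and xv2: "integrable lborel (\<lambda>x. (cmod (of_real x * v x))\<^sup>2)"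
  obtains G where "G \<in> borel_measurable lborel" "integrable lborel (\<lambda>\<xi>. (cmod (G \<xi>))\<^sup>2)"
    "\<And>a b. a \<le> b \<Longrightarrow> fourier v b - fourier v a = (LINT \<xi>:{a..b}|lborel. G \<xi>)"
proof -
  have v: "integrable lborel v"
    by (rule integrable_weighted_L2[OF vm v2 xv2])
  define p where "p n x = indicator {- real n..real n} x *\<^sub>R v x" for n x
  define P where "P n x = - \<i> * of_real x * p n x" for n x
  \<comment> \<open>Later truncations differ from the \<open>n\<close>-th only outside
    \<open>{- n..n}\<close>, so this tail bounds all their distances from it at once.\<close>
  define T where "T n = (\<integral>x. indicator (- {- real n..real n}) x * (cmod (of_real x * v x))\<^sup>2 \<partial>lborel)" for n
  have p: "integrable lborel (p n)" for n
    unfolding p_def using v by (intro integrable_mult_indicator) auto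
  have P: "integrable lborel (P n)" for n
  proof (rule Bochner_Integration.integrable_bound)
    show "integrable lborel (\<lambda>x. real n * cmod (v x))" using v by simp
    show "P n \<in> borel_measurable lborel" unfolding P_def p_def by measurable
    show "AE x in lborel. cmod (P n x) \<le> norm (real n * cmod (v x))"
      by (intro AE_I2) (auto simp: P_def p_def norm_mult indicator_def intro!: mult_right_mono)
  qed
  have P2: "integrable lborel (\<lambda>x. (cmod (P n x))\<^sup>2)" for n
  proof (rule Bochner_Integration.integrable_bound[OF xv2])
    show "(\<lambda>x. (cmod (P n x))\<^sup>2) \<in> borel_measurable lborel" unfolding P_def p_def by measurable
    show "AE x in lborel. norm ((cmod (P n x))\<^sup>2) \<le> norm ((cmod (of_real x * v x))\<^sup>2)"
      by (intro AE_I2) (auto simp: P_def p_def norm_mult indicator_def)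
  qed
  have T0: "T \<longlonglongrightarrow> 0"
    unfolding T_def using tail_tendsto_zero[OF xv2] filterlim_real_sequentially by (rule filterlim_compose)
  have T_nonneg: "0 \<le> T n" for n
    unfolding T_def by (intro Bochner_Integration.integral_nonneg) simp
  have cauchy: "(\<integral>\<^sup>+\<xi>. ennreal ((cmod (fourier (P m) \<xi> - fourier (P n) \<xi>))\<^sup>2) \<partial>lborel) \<le> ennreal (T n)" if "n \<le> m" for m n
  proof -
    have "(\<integral>\<^sup>+\<xi>. ennreal ((cmod (fourier (P m) \<xi> - fourier (P n) \<xi>))\<^sup>2) \<partial>lborel) \<le>
        (\<integral>\<^sup>+x. ennreal ((cmod (P m x - P n x))\<^sup>2) \<partial>lborel)"
      unfolding fourier_diff[OF P P] by (intro fourier_square_norm_le Bochner_Integration.integrable_diff P)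
    also have "\<dots> \<le> (\<integral>\<^sup>+x. ennreal (indicator (- {- real n..real n}) x * (cmod (of_real x * v x))\<^sup>2) \<partial>lborel)"
      using that by (intro nn_integral_mono ennreal_leI) (auto simp: P_def p_def indicator_def norm_mult)
    also have "\<dots> = ennreal (T n)"
      unfolding T_def using integrable_mult_indicator[OF _ xv2, of "- {- real n..real n}"]
      by (intro nn_integral_eq_integral AE_I2) (simp_all add: indicator_def)
    finally show ?thesis .
  qed
  obtain G where G [measurable]: "G \<in> borel_measurable lborel"
    and GT: "\<And>n. (\<integral>\<^sup>+\<xi>. ennreal ((cmod (G \<xi> - fourier (P n) \<xi>))\<^sup>2) \<partial>lborel) \<le> ennreal (T n)"
    using L2_limit[of "\<lambda>n. fourier (P n)" lborel T, OF measurable_fourier[OF P] cauchy T0] by blast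
  have FP2: "integrable lborel (\<lambda>\<xi>. (cmod (fourier (P n) \<xi>))\<^sup>2)" for n
    by (rule fourier_square_integrable[OF P P2])
  have G2: "integrable lborel (\<lambda>\<xi>. (cmod (G \<xi>))\<^sup>2)"
    by (rule integrable_square_diff[OF G measurable_fourier[OF P] _ FP2[of 0]]) (use GT[of 0] in \<open>auto intro: le_less_trans\<close>)
  \<comment> \<open>One sequence has two limits: the integrals of \<open>fourier (P n)\<close>
    converge by mean-square convergence to \<open>G\<close>, and the increments of
    \<open>fourier (p n)\<close>, which equal them, converge pointwise by domination.\<close>
  have "fourier v b - fourier v a = (LINT \<xi>:{a..b}|lborel. G \<xi>)" if ab: "a \<le> b" for a b
  proof (rule LIMSEQ_unique)
    show "(\<lambda>n. LINT \<xi>:{a..b}|lborel. fourier (P n) \<xi>) \<longlonglongrightarrow> (LINT \<xi>:{a..b}|lborel. G \<xi>)"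
      using ab by (intro set_integral_L2_tendsto[OF _ _ measurable_fourier[OF P] G GT T0 T_nonneg]
          square_integrable_imp_set_integrable_Icc measurable_fourier P FP2 G G2)
    have lim: "(\<lambda>n. fourier (p n) \<xi>) \<longlonglongrightarrow> fourier v \<xi>" for \<xi>
      unfolding fourier_def
    proof (intro tendsto_mult tendsto_const integral_dominated_convergence[where w = "\<lambda>x. cmod (v x)"])
      show "AE x in lborel. (\<lambda>n. p n x * exp (- (\<i> * of_real (x * \<xi>)))) \<longlonglongrightarrow> v x * exp (- (\<i> * of_real (x * \<xi>)))"
      proof (intro AE_I2 tendsto_mult tendsto_const tendsto_eventually)
        show "\<forall>\<^sub>F n in sequentially. p n x = v x" for x
          using eventually_ge_at_top[of "nat \<lceil>\<bar>x\<bar>\<rceil>"] by eventually_elim (auto simp: p_def indicator_def; linarith)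
      qed
      show "AE x in lborel. cmod (p n x * exp (- (\<i> * of_real (x * \<xi>)))) \<le> cmod (v x)" for n
        by (intro AE_I2) (auto simp: norm_mult p_def indicator_def)
    qed (use v p in \<open>auto intro!: borel_measurable_integrable integrable_fourier\<close>)
    have "(\<lambda>n. fourier (p n) b - fourier (p n) a) \<longlonglongrightarrow> fourier v b - fourier v a"
      by (intro tendsto_diff lim)
    moreover have "fourier (p n) b - fourier (p n) a = (LINT \<xi>:{a..b}|lborel. fourier (P n) \<xi>)" for n
      using fourier_increment[OF p P[unfolded P_def[abs_def]] ab] by (simp add: P_def[abs_def])
    ultimately show "(\<lambda>n. LINT \<xi>:{a..b}|lborel. fourier (P n) \<xi>) \<longlonglongrightarrow> fourier v b - fourier v a"
      by simp
  qed
  with G G2 show ?thesis by (rule that)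
qed

subsection \<open>Borel versions and uniqueness of the transform\<close>

lemma lebesgue_borel_version:
  fixes f :: "real \<Rightarrow> complex"
  assumes f: "f \<in> borel_measurable lebesgue"
  obtains g where "g \<in> borel_measurable lborel" "AE x in lebesgue. f x = g x"
proof -
  have "(\<lambda>x. Re (f x)) \<in> borel_measurable lebesgue" "(\<lambda>x. Im (f x)) \<in> borel_measurable lebesgue"
    using f by measurable
  then obtain g1 g2 where g [measurable]: "g1 \<in> borel_measurable lborel" "g2 \<in> borel_measurable lborel"
    and eq: "AE x in lborel. Re (f x) = g1 x" "AE x in lborel. Im (f x) = g2 x"
    by (auto dest!: completion_ex_borel_measurable_real)
  have "(\<lambda>x. Complex (g1 x) (g2 x)) \<in> borel_measurable lborel"
    unfolding Complex_eq by measurable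
  moreover have "AE x in lborel. f x = Complex (g1 x) (g2 x)"
    using eq by eventually_elim (simp add: complex_eq_iff)
  ultimately show ?thesis
    by (intro that[of "\<lambda>x. Complex (g1 x) (g2 x)"]) (simp_all add: AE_completion_iff)
qed

lemma square_integrable_on_UNIV_iff:
  fixes f :: "real \<Rightarrow> complex"
  shows "f square_integrable_on UNIV \<longleftrightarrow> f \<in> borel_measurable lebesgue \<and> integrable lebesgue (\<lambda>x. (cmod (f x))\<^sup>2)"
  by (simp add: square_integrable_on_def set_borel_measurable_def set_integrable_def)

lemma square_integrable_on_version:
  fixes f g :: "real \<Rightarrow> complex"
  assumes f: "f square_integrable_on S" and g: "g \<in> borel_measurable lborel" and S: "S \<in> sets lborel"
    and eq: "AE x in lebesgue. f x = g x"
  shows "integrable lborel (\<lambda>x. indicator S x * (cmod (g x))\<^sup>2)"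
proof -
  note [measurable] = g S
  have m: "(\<lambda>x. indicator S x * (cmod (g x))\<^sup>2) \<in> borel_measurable lborel"
    by measurable
  have "integrable lebesgue (\<lambda>x. indicator S x * (cmod (f x))\<^sup>2)"
    using f by (simp add: square_integrable_on_def set_integrable_def)
  then have "integrable lebesgue (\<lambda>x. indicator S x * (cmod (g x))\<^sup>2)"
    by (rule integrable_cong_AE_imp)
      (use eq m in \<open>auto intro: measurable_completion elim: AE_mp\<close>)
  then show ?thesis
    by (simp add: integrable_completion[OF m])
qed

lemma integral_lebesgue_cong:
  fixes f g :: "real \<Rightarrow> 'a :: {banach, second_countable_topology}"
  assumes "f \<in> borel_measurable lebesgue" and "g \<in> borel_measurable lborel" and "AE x in lebesgue. f x = g x"
  shows "(LINT x|lebesgue. f x) = (LINT x|lborel. g x)"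
  using assms by (subst integral_completion[symmetric]) (auto intro!: integral_cong_AE measurable_completion)

lemma truncated_fourier_eq:
  assumes m: "u0 \<in> borel_measurable lebesgue" "v \<in> borel_measurable lborel" and eq: "AE x in lebesgue. u0 x = v x"
  shows "truncated_fourier R u0 = fourier (\<lambda>x. indicator {-R..R} x *\<^sub>R v x)"
proof
  fix \<xi>
  note [measurable] = m(2) measurable_completion[OF m(2)] m(1)
  have "(LINT x|lebesgue. indicat_real {- R..R} x *\<^sub>R (exp (- (\<i> * of_real (x * \<xi>))) * u0 x)) =
      (LINT x|lborel. indicator {- R..R} x *\<^sub>R v x * exp (- (\<i> * of_real (x * \<xi>))))"
  proof (rule integral_lebesgue_cong)
    show "(\<lambda>x. indicat_real {- R..R} x *\<^sub>R (exp (- (\<i> * of_real (x * \<xi>))) * u0 x)) \<in> borel_measurable lebesgue"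
    proof -
      have "(\<lambda>x. indicat_real {- R..R} x *\<^sub>R exp (- (\<i> * complex_of_real (x * \<xi>)))) \<in> borel_measurable lebesgue"
        by (rule measurable_completion) measurable
      then have "(\<lambda>x. indicat_real {- R..R} x *\<^sub>R exp (- (\<i> * complex_of_real (x * \<xi>))) * u0 x) \<in> borel_measurable lebesgue"
        using m(1) by (rule borel_measurable_times)
      then show ?thesis by simp
    qed
    show "AE x in lebesgue. indicat_real {- R..R} x *\<^sub>R (exp (- (\<i> * of_real (x * \<xi>))) * u0 x) =
        indicator {- R..R} x *\<^sub>R v x * exp (- (\<i> * of_real (x * \<xi>)))"
      using eq by eventually_elim simp
  qed measurable
  then show "truncated_fourier R u0 \<xi> = fourier (\<lambda>x. indicator {-R..R} x *\<^sub>R v x) \<xi>"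
    by (simp only: truncated_fourier_def fourier_def set_lebesgue_integral_def)
qed

text \<open>Existence of a transform is what gives the choice in \<open>L2_fourier\<close> a
  meaning: with a witness at hand, the chosen function has the defining property too.\<close>

lemma has_L2_fourier_transform_fourier:
  assumes m: "u0 \<in> borel_measurable lebesgue" "v \<in> borel_measurable lborel" and eq: "AE x in lebesgue. u0 x = v x"
    and v: "integrable lborel v" and v2: "integrable lborel (\<lambda>x. (cmod (v x))\<^sup>2)"
  shows "u0 has_L2_fourier_transform fourier v"
  unfolding has_L2_fourier_transform_def
proof
  have [measurable]: "fourier v \<in> borel_measurable lborel" by (rule measurable_fourier[OF v])
  have "integrable lebesgue (\<lambda>\<xi>. (cmod (fourier v \<xi>))\<^sup>2)"
    by (subst integrable_completion) (measurable, rule fourier_square_integrable[OF v v2])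
  then show "fourier v square_integrable_on UNIV"
    by (simp add: square_integrable_on_UNIV_iff measurable_completion)
  show "((\<lambda>R. \<integral>\<^sup>+ \<xi>. ennreal ((cmod (truncated_fourier R u0 \<xi> - fourier v \<xi>))\<^sup>2) \<partial>lebesgue) \<longlongrightarrow> 0) at_top"
  proof (rule tendsto_sandwich[where f = "\<lambda>_. 0", OF _ _ tendsto_const])
    show "\<forall>\<^sub>F R in at_top. (\<integral>\<^sup>+ \<xi>. ennreal ((cmod (truncated_fourier R u0 \<xi> - fourier v \<xi>))\<^sup>2) \<partial>lebesgue) \<le>
        ennreal (\<integral>x. indicator (- {-R..R}) x * (cmod (v x))\<^sup>2 \<partial>lborel)"
      unfolding truncated_fourier_eq[OF m eq] nn_integral_completion
      by (intro always_eventually allI fourier_truncation_error v v2)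
    show "((\<lambda>R. ennreal (\<integral>x. indicator (- {-R..R}) x * (cmod (v x))\<^sup>2 \<partial>lborel)) \<longlongrightarrow> 0) at_top"
      using tendsto_ennrealI[OF tail_tendsto_zero[OF v2]] by simp
  qed auto
qed

text \<open>The distance between two mean-square limits does not depend on \<open>R\<close>, yet is
  bounded by errors that tend to 0 with \<open>R\<close>. Measurability of the truncated transforms
  enters because extended integrals are additive on measurable functions.\<close>

lemma has_L2_fourier_transform_unique:
  assumes F: "u0 has_L2_fourier_transform F" and w: "u0 has_L2_fourier_transform w"
    and tr: "\<And>R. truncated_fourier R u0 \<in> borel_measurable lebesgue"
  shows "AE \<xi> in lebesgue. w \<xi> = F \<xi>"
proof -
  have [measurable]: "F \<in> borel_measurable lebesgue" "w \<in> borel_measurable lebesgue"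
    using F w by (auto simp: has_L2_fourier_transform_def square_integrable_on_UNIV_iff)
  note [measurable] = tr
  let ?I = "\<lambda>w R. \<integral>\<^sup>+ \<xi>. ennreal ((cmod (truncated_fourier R u0 \<xi> - w \<xi>))\<^sup>2) \<partial>lebesgue"
  have le: "(\<integral>\<^sup>+ \<xi>. ennreal ((cmod (w \<xi> - F \<xi>))\<^sup>2) \<partial>lebesgue) \<le> 2 * ?I w R + 2 * ?I F R" for R
  proof -
    have "ennreal ((cmod (w \<xi> - F \<xi>))\<^sup>2) \<le> 2 * ennreal ((cmod (truncated_fourier R u0 \<xi> - w \<xi>))\<^sup>2)
        + 2 * ennreal ((cmod (truncated_fourier R u0 \<xi> - F \<xi>))\<^sup>2)" for \<xi>
    proof -
      let ?z = "truncated_fourier R u0 \<xi>"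
      have "(cmod (w \<xi> - F \<xi>))\<^sup>2 \<le> (cmod (?z - w \<xi>) + cmod (?z - F \<xi>))\<^sup>2"
        using norm_triangle_ineq4[of "?z - F \<xi>" "?z - w \<xi>"] by (intro power_mono) auto
      also have "\<dots> \<le> 2 * (cmod (?z - w \<xi>))\<^sup>2 + 2 * (cmod (?z - F \<xi>))\<^sup>2"
        using sum_squares_bound[of "cmod (?z - w \<xi>)" "cmod (?z - F \<xi>)"] by (simp add: power2_sum)
      finally have "ennreal ((cmod (w \<xi> - F \<xi>))\<^sup>2) \<le> ennreal (2 * (cmod (?z - w \<xi>))\<^sup>2 + 2 * (cmod (?z - F \<xi>))\<^sup>2)"
        by (rule ennreal_leI)
      then show ?thesis by (simp add: ennreal_mult)
    qed
    then have "(\<integral>\<^sup>+ \<xi>. ennreal ((cmod (w \<xi> - F \<xi>))\<^sup>2) \<partial>lebesgue) \<le>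
        (\<integral>\<^sup>+ \<xi>. 2 * ennreal ((cmod (truncated_fourier R u0 \<xi> - w \<xi>))\<^sup>2)
          + 2 * ennreal ((cmod (truncated_fourier R u0 \<xi> - F \<xi>))\<^sup>2) \<partial>lebesgue)"
      by (intro nn_integral_mono)
    also have "\<dots> = 2 * ?I w R + 2 * ?I F R"
      by (subst nn_integral_add) (simp_all add: nn_integral_cmult)
    finally show ?thesis .
  qed
  have "(?I w \<longlongrightarrow> 0) at_top" "(?I F \<longlongrightarrow> 0) at_top"
    using F w by (simp_all add: has_L2_fourier_transform_def)
  then have "((\<lambda>R. 2 * ?I w R + 2 * ?I F R) \<longlongrightarrow> 2 * 0 + 2 * 0) at_top"
    by (intro tendsto_add ennreal_tendsto_cmult) simp_all
  then have "(\<integral>\<^sup>+ \<xi>. ennreal ((cmod (w \<xi> - F \<xi>))\<^sup>2) \<partial>lebesgue) \<le> 2 * 0 + 2 * 0"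
    by (rule tendsto_lowerbound[OF _ always_eventually[OF allI[OF le]]]) simp
  then have "(\<integral>\<^sup>+ \<xi>. ennreal ((cmod (w \<xi> - F \<xi>))\<^sup>2) \<partial>lebesgue) = 0"
    by simp
  then have "AE \<xi> in lebesgue. ennreal ((cmod (w \<xi> - F \<xi>))\<^sup>2) = 0"
    by (subst (asm) nn_integral_0_iff_AE) auto
  then show ?thesis
    by eventually_elim simp
qed

subsection \<open>Weak derivatives\<close>

lemma test_function_differentiable:
  assumes "test_function \<phi>"
  shows "(\<phi> has_real_derivative deriv \<phi> x) (at x)" and "continuous_on S \<phi>" and "continuous_on S (deriv \<phi>)"
proof -
  have d: "(deriv ^^ n) \<phi> differentiable at x" for n x
    using assms by (simp add: test_function_def)
  from d[of 0] show *: "(\<phi> has_real_derivative deriv \<phi> x) (at x)" for x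
    by (simp add: DERIV_deriv_iff_real_differentiable)
  show "continuous_on S \<phi>"
    using d[of 0] by (auto intro!: continuous_at_imp_continuous_on differentiable_imp_continuous_within)
  show "continuous_on S (deriv \<phi>)"
    using d[of 1] by (auto intro!: continuous_at_imp_continuous_on differentiable_imp_continuous_within)
qed

lemma test_function_bounded_support:
  assumes "test_function \<phi>"
  obtains M where "M > 0" "\<And>x. M \<le> \<bar>x\<bar> \<Longrightarrow> \<phi> x = 0" "\<And>x. M \<le> \<bar>x\<bar> \<Longrightarrow> deriv \<phi> x = 0"
proof -
  have "bounded {x. \<phi> x \<noteq> 0}"
    using assms bounded_subset[OF compact_imp_bounded closure_subset] by (auto simp: test_function_def)
  then obtain B where B: "\<And>x. \<phi> x \<noteq> 0 \<Longrightarrow> \<bar>x\<bar> \<le> B"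
    unfolding bounded_iff by auto
  \<comment> \<open>The extra 1 puts every point in question inside an open set on which
    \<open>\<phi>\<close> vanishes, so that its derivative vanishes there as well.\<close>
  show ?thesis
  proof (rule that[of "\<bar>B\<bar> + 1"])
    fix x :: real assume x: "\<bar>B\<bar> + 1 \<le> \<bar>x\<bar>"
    then show "\<phi> x = 0" using B[of x] by force
    have "((\<lambda>_. 0) has_real_derivative 0) (at x)" by simp
    then have "(\<phi> has_real_derivative 0) (at x)"
    proof (rule has_field_derivative_transform_within_open[of _ _ _ "- {- \<bar>B\<bar>..\<bar>B\<bar>}"])
      fix y assume "y \<in> - {- \<bar>B\<bar>..\<bar>B\<bar>}"
      then show "0 = \<phi> y" using B[of y] by (cases "\<phi> y = 0") auto
    qed (use x in auto)
    then show "deriv \<phi> x = 0" by (rule DERIV_imp_deriv)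
  qed simp
qed

lemma locally_integrable_version:
  assumes m: "w \<in> borel_measurable lebesgue" "F \<in> borel_measurable lborel"
    and eq: "AE x in lebesgue. w x = F x" and F: "\<And>a b. set_integrable lborel {a..b} F"
  shows "locally_integrable w"
  unfolding locally_integrable_def
proof (intro allI impI)
  fix K :: "real set" assume K: "compact K"
  then obtain B where "\<And>x. x \<in> K \<Longrightarrow> \<bar>x\<bar> \<le> B"
    using compact_imp_bounded[OF K] unfolding bounded_iff by auto
  then have "K \<subseteq> {-B..B}"
    by (force simp: abs_le_iff)
  have KS: "K \<in> sets lebesgue"
    by (intro sets_completionI_sets) (simp add: borel_compact K)
  note [measurable] = m(2)
  have "(\<lambda>x. indicat_real {-B..B} x *\<^sub>R F x) \<in> borel_measurable lborel" by measurable
  then have "set_integrable lebesgue {-B..B} F"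
    using F[of "-B" B] by (simp add: set_integrable_def integrable_completion)
  then have "set_integrable lebesgue K F"
    by (rule set_integrable_subset[OF _ KS \<open>K \<subseteq> {-B..B}\<close>])
  then show "set_integrable lebesgue K w"
    unfolding set_integrable_def
  proof (rule integrable_cong_AE_imp)
    show "(\<lambda>x. indicat_real K x *\<^sub>R w x) \<in> borel_measurable lebesgue"
      by (intro borel_measurable_scaleR borel_measurable_indicator KS m(1))
    show "AE x in lebesgue. indicat_real K x *\<^sub>R F x = indicat_real K x *\<^sub>R w x"
      using eq by eventually_elim simp
  qed
qed

lemma locally_integrable_borel_version:
  assumes "locally_integrable g"
  obtains g' where "g' \<in> borel_measurable lborel" "g \<in> borel_measurable lebesgue" "AE x in lebesgue. g x = g' x"
    "\<And>a b. set_integrable lborel {a..b} g'"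
proof -
  have int: "integrable lebesgue (\<lambda>x. indicat_real {a..b} x *\<^sub>R g x)" for a b
    using assms by (auto simp: locally_integrable_def set_integrable_def)
  \<comment> \<open>Local integrability gives measurability on bounded intervals; globally,
    \<open>g\<close> is the pointwise limit of its truncations.\<close>
  have g: "g \<in> borel_measurable lebesgue"
  proof (rule borel_measurable_LIMSEQ_metric)
    show "(\<lambda>x. indicat_real {- real n..real n} x *\<^sub>R g x) \<in> borel_measurable lebesgue" for n
      using int by (rule borel_measurable_integrable)
    show "(\<lambda>n. indicat_real {- real n..real n} x *\<^sub>R g x) \<longlonglongrightarrow> g x" for x
    proof (rule tendsto_eventually)
      show "\<forall>\<^sub>F n in sequentially. indicat_real {- real n..real n} x *\<^sub>R g x = g x"
        using eventually_ge_at_top[of "nat \<lceil>\<bar>x\<bar>\<rceil>"] by eventually_elim (auto simp: indicator_def; linarith)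
    qed
  qed
  obtain g' where g' [measurable]: "g' \<in> borel_measurable lborel" and eq: "AE x in lebesgue. g x = g' x"
    using lebesgue_borel_version[OF g] .
  have "set_integrable lborel {a..b} g'" for a b
  proof -
    have m: "(\<lambda>x. indicat_real {a..b} x *\<^sub>R g' x) \<in> borel_measurable lborel" by measurable
    have "integrable lebesgue (\<lambda>x. indicat_real {a..b} x *\<^sub>R g' x)"
      by (rule integrable_cong_AE_imp[OF int]) (use eq measurable_completion[OF m] in \<open>auto elim: AE_mp\<close>)
    then show ?thesis
      by (simp add: set_integrable_def integrable_completion[OF m])
  qed
  with g' g eq show ?thesis by (rule that)
qed

text \<open>Integration by parts with the test function as the smooth factor, on an interval at
  whose ends it vanishes. Besides identifying a weak derivative, this proves that one exists, as the
  choice in \<open>weak_deriv\<close> demands.\<close>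

lemma weak_derivative_of_indefinite_integral:
  fixes F G w :: "real \<Rightarrow> complex"
  assumes w: "w \<in> borel_measurable lebesgue" and eq: "AE \<xi> in lebesgue. w \<xi> = F \<xi>"
    and F: "continuous_on UNIV F" and G: "G \<in> borel_measurable lborel" "\<And>a b. set_integrable lborel {a..b} G"
    and FG: "\<And>a b. a \<le> b \<Longrightarrow> F b - F a = (LINT \<xi>:{a..b}|lborel. G \<xi>)"
  shows "w has_weak_derivative G"
  unfolding has_weak_derivative_def
proof (intro conjI allI impI)
  have Fm: "F \<in> borel_measurable lborel"
    using borel_measurable_continuous_onI[OF F] by simp
  show "locally_integrable w"
    using F by (intro locally_integrable_version[OF w Fm eq] borel_integrable_atLeastAtMost') (auto intro: continuous_on_subset)
  show "locally_integrable G"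
    by (intro locally_integrable_version[OF measurable_completion[OF G(1)] G(1)] G(2)) simp
  fix \<phi> assume \<phi>: "test_function \<phi>"
  obtain M where M: "M > 0" "\<And>x. M \<le> \<bar>x\<bar> \<Longrightarrow> \<phi> x = 0" "\<And>x. M \<le> \<bar>x\<bar> \<Longrightarrow> deriv \<phi> x = 0"
    using test_function_bounded_support[OF \<phi>] by blast
  have [measurable]: "\<phi> \<in> borel_measurable lborel" "deriv \<phi> \<in> borel_measurable lborel"
    using test_function_differentiable(2,3)[OF \<phi>, of UNIV] by (auto intro: borel_measurable_continuous_onI)
  note [measurable] = Fm G(1)
  have out: "\<phi> x = 0" "deriv \<phi> x = 0" if "x \<notin> {-M..M}" for x
    using that M(2,3)[of x] by (auto simp: abs_le_iff not_le)
  have "(LINT \<xi>|lebesgue. deriv \<phi> \<xi> *\<^sub>R w \<xi>) = (LINT \<xi>|lborel. deriv \<phi> \<xi> *\<^sub>R F \<xi>)"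
  proof (rule integral_lebesgue_cong)
    show "(\<lambda>\<xi>. deriv \<phi> \<xi> *\<^sub>R w \<xi>) \<in> borel_measurable lebesgue"
      by (intro borel_measurable_scaleR[OF measurable_completion w]) measurable
    show "AE \<xi> in lebesgue. deriv \<phi> \<xi> *\<^sub>R w \<xi> = deriv \<phi> \<xi> *\<^sub>R F \<xi>"
      using eq by eventually_elim simp
  qed measurable
  also have "\<dots> = (LINT \<xi>:{-M..M}|lborel. of_real (deriv \<phi> \<xi>) * F \<xi>)"
    unfolding set_lebesgue_integral_def
  proof (intro Bochner_Integration.integral_cong refl)
    show "deriv \<phi> \<xi> *\<^sub>R F \<xi> = indicat_real {-M..M} \<xi> *\<^sub>R (of_real (deriv \<phi> \<xi>) * F \<xi>)" for \<xi>
      using out(2)[of \<xi>] by (cases "\<xi> \<in> {-M..M}") (simp_all add: scaleR_conv_of_real)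
  qed
  also have "\<dots> = of_real (\<phi> M) * F M - of_real (\<phi> (-M)) * F (-M) - (LINT \<xi>:{-M..M}|lborel. of_real (\<phi> \<xi>) * G \<xi>)"
  proof (rule integration_by_parts_indefinite)
    show "((\<lambda>\<xi>. complex_of_real (\<phi> \<xi>)) has_vector_derivative complex_of_real (deriv \<phi> y)) (at y within {-M..M})" for y
      by (rule has_vector_derivative_of_real[OF has_field_derivative_at_within[OF test_function_differentiable(1)[OF \<phi>]]])
    show "continuous_on {-M..M} (\<lambda>\<xi>. complex_of_real (deriv \<phi> \<xi>))"
      by (intro continuous_on_of_real test_function_differentiable(3)[OF \<phi>])
    show "continuous_on {-M..M} F"
      by (rule continuous_on_subset[OF F]) simp
    show "-M \<le> M"
      using M(1) by simp
  qed (rule G FG; assumption)+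
  also have "\<dots> = - (LINT \<xi>:{-M..M}|lborel. of_real (\<phi> \<xi>) * G \<xi>)"
    using M(1) M(2)[of M] M(2)[of "-M"] by simp
  also have "(LINT \<xi>:{-M..M}|lborel. of_real (\<phi> \<xi>) * G \<xi>) = (LINT \<xi>|lborel. \<phi> \<xi> *\<^sub>R G \<xi>)"
    unfolding set_lebesgue_integral_def
  proof (intro Bochner_Integration.integral_cong refl)
    show "indicat_real {-M..M} \<xi> *\<^sub>R (of_real (\<phi> \<xi>) * G \<xi>) = \<phi> \<xi> *\<^sub>R G \<xi>" for \<xi>
      using out(1)[of \<xi>] by (cases "\<xi> \<in> {-M..M}") (simp_all add: scaleR_conv_of_real)
  qed
  also have "\<dots> = (LINT \<xi>|lebesgue. \<phi> \<xi> *\<^sub>R G \<xi>)"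
    by (rule integral_completion[symmetric]) measurable
  finally show "(LINT \<xi>|lebesgue. deriv \<phi> \<xi> *\<^sub>R w \<xi>) = - (LINT \<xi>|lebesgue. \<phi> \<xi> *\<^sub>R G \<xi>)" .
qed

text \<open>Cutoffs tending to the indicator of \<open>{a..b}\<close> are admissible test functions,
  and against each of them the two weak derivatives agree. Integrals over intervals are the form in
  which the derivative enters integration by parts.\<close>

lemma weak_derivative_integral_unique:
  assumes w: "w has_weak_derivative g" "w has_weak_derivative G"
    and g: "g \<in> borel_measurable lebesgue" "g' \<in> borel_measurable lborel" "AE x in lebesgue. g x = g' x"
      "\<And>a b. set_integrable lborel {a..b} g'"
    and G: "G \<in> borel_measurable lborel" "\<And>a b. set_integrable lborel {a..b} G"
    and "a < b"
  shows "(LINT x:{a..b}|lborel. g' x) = (LINT x:{a..b}|lborel. G x)"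
proof (rule LIMSEQ_unique)
  let ?\<phi> = "\<lambda>n. bump (1 / real (Suc n)) a b 1 0"
  show "(\<lambda>n. LINT x|lborel. ?\<phi> n x *\<^sub>R G x) \<longlonglongrightarrow> (LINT x:{a..b}|lborel. G x)"
    by (intro test_function_approximates_interval G \<open>a < b\<close>)
  have "(\<lambda>n. LINT x|lborel. ?\<phi> n x *\<^sub>R g' x) \<longlonglongrightarrow> (LINT x:{a..b}|lborel. g' x)"
    by (intro test_function_approximates_interval g \<open>a < b\<close>)
  moreover have "(LINT x|lborel. ?\<phi> n x *\<^sub>R g' x) = (LINT x|lborel. ?\<phi> n x *\<^sub>R G x)" for n
  proof -
    have \<phi>: "test_function (?\<phi> n)"
      using \<open>a < b\<close> by (intro test_function_bump) auto
    have \<phi>m [measurable]: "?\<phi> n \<in> borel_measurable lborel"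
      using test_function_differentiable(2)[OF \<phi>, of UNIV] by (auto intro: borel_measurable_continuous_onI)
    note [measurable] = g(2) G(1)
    have "(LINT x|lborel. ?\<phi> n x *\<^sub>R g' x) = (LINT x|lebesgue. ?\<phi> n x *\<^sub>R g x)"
    proof (rule integral_lebesgue_cong[symmetric])
      show "(\<lambda>x. ?\<phi> n x *\<^sub>R g x) \<in> borel_measurable lebesgue"
        by (rule borel_measurable_scaleR[OF measurable_completion g(1)]) fact
      show "AE x in lebesgue. ?\<phi> n x *\<^sub>R g x = ?\<phi> n x *\<^sub>R g' x"
        using g(3) by eventually_elim simp
    qed measurable
    also have "\<dots> = (LINT x|lebesgue. ?\<phi> n x *\<^sub>R G x)"
      using w \<phi> by (auto simp: has_weak_derivative_def)
    also have "\<dots> = (LINT x|lborel. ?\<phi> n x *\<^sub>R G x)"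
      by (rule integral_completion) measurable
    finally show ?thesis .
  qed
  ultimately show "(\<lambda>n. LINT x|lborel. ?\<phi> n x *\<^sub>R G x) \<longlonglongrightarrow> (LINT x:{a..b}|lborel. g' x)"
    by simp
qed

text \<open>On \<open>{a..b}\<close> the function \<open>h\<close> differs from \<open>G\<close> by
  \<open>g - G\<close> on an intersection of two intervals. This is again an interval, so the
  integral of the difference over it is 0.\<close>

lemma patched_indefinite_integral:
  fixes g G :: "real \<Rightarrow> complex"
  assumes g: "\<And>a b. set_integrable lborel {a..b} g" and G: "\<And>a b. set_integrable lborel {a..b} G"
    and eq: "\<And>a b. a < b \<Longrightarrow> (LINT x:{a..b}|lborel. g x) = (LINT x:{a..b}|lborel. G x)"
    and h: "\<And>x. h x = (if x \<in> {c..d} then g x else G x)"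
  shows "set_integrable lborel {a..b} h" and "(LINT x:{a..b}|lborel. h x) = (LINT x:{a..b}|lborel. G x)"
proof -
  have "{a..b} \<inter> {c..d} = {max a c..min b d}" by auto
  then have split: "indicat_real {a..b} x *\<^sub>R h x =
      indicat_real {a..b} x *\<^sub>R G x + indicat_real {max a c..min b d} x *\<^sub>R (g x - G x)" for x
    by (auto simp: h indicator_def)
  have gG: "set_integrable lborel {max a c..min b d} (\<lambda>x. g x - G x)"
    by (intro set_integral_diff g G)
  show "set_integrable lborel {a..b} h"
    using G[of a b] gG unfolding set_integrable_def split by (rule Bochner_Integration.integrable_add)
  \<comment> \<open>The intersection may be empty or a single point, where \<open>eq\<close> does
    not apply; such a set is negligible.\<close>
  have "(LINT x:{s..t}|lborel. g x - G x) = 0" for s t :: real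
  proof (cases "s < t")
    case True
    then show ?thesis using eq[of s t] by (simp add: set_integral_diff g G)
  next
    case False
    have "AE x in lborel. indicat_real {s..t} x *\<^sub>R (g x - G x) = 0"
      using AE_lborel_singleton[of s] by eventually_elim (use False in \<open>auto simp: indicator_def\<close>)
    then show ?thesis
      unfolding set_lebesgue_integral_def by (rule integral_eq_zero_AE)
  qed
  then show "(LINT x:{a..b}|lborel. h x) = (LINT x:{a..b}|lborel. G x)"
    using G[of a b] gG unfolding set_lebesgue_integral_def set_integrable_def split
    by (subst Bochner_Integration.integral_add) auto
qed

text \<open>Near the origin \<open>z \<le> 1 + z\<^sup>2\<close> on a bounded interval; away from it
  the product of \<open>cmod (q \<xi>)\<close> and \<open>1 / \<bar>\<xi>\<bar>\<close> is at most
  the sum of their squares, and \<open>1 / \<xi>\<^sup>2\<close> is at most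
  \<open>2 / (1 + \<xi>\<^sup>2)\<close>. The points 1 and -1 belong to neither region and are
  discarded.\<close>

lemma integrable_from_L2_pieces:
  fixes p q :: "real \<Rightarrow> complex"
  assumes [measurable]: "p \<in> borel_measurable lborel"
    and p: "integrable lborel (\<lambda>\<xi>. indicator {-1<..<1} \<xi> * (cmod (p \<xi>))\<^sup>2)"
    and q: "integrable lborel (\<lambda>\<xi>. (cmod (q \<xi>))\<^sup>2)"
    and pq: "\<And>\<xi>. \<bar>\<xi>\<bar> > 1 \<Longrightarrow> cmod (p \<xi>) \<le> cmod (q \<xi>) / \<bar>\<xi>\<bar>"
  shows "integrable lborel p"
proof (rule Bochner_Integration.integrable_bound)
  let ?b = "\<lambda>\<xi>. indicat_real {-1..1} \<xi> + indicator {-1<..<1} \<xi> * (cmod (p \<xi>))\<^sup>2 + (cmod (q \<xi>))\<^sup>2 + 2 * (1 / (1 + \<xi>\<^sup>2))"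
  show "integrable lborel ?b"
    by (intro Bochner_Integration.integrable_add integrable_mult_right integrable_indicator_Icc p q integrable_inverse_one_plus_square)
  show "AE \<xi> in lborel. cmod (p \<xi>) \<le> norm (?b \<xi>)"
    using AE_lborel_singleton[of 1] AE_lborel_singleton[of "-1"]
  proof eventually_elim
    case (elim \<xi>)
    have "cmod (p \<xi>) \<le> ?b \<xi>"
    proof (cases "\<bar>\<xi>\<bar> < 1")
      case True
      have "cmod (p \<xi>) \<le> 1 + (cmod (p \<xi>))\<^sup>2"
        using sum_squares_bound[of 1 "cmod (p \<xi>)"] by (simp add: algebra_simps) (smt (verit) norm_ge_zero)
      moreover have "0 \<le> (cmod (q \<xi>))\<^sup>2 + 2 * (1 / (1 + \<xi>\<^sup>2))"
        by (intro add_nonneg_nonneg) auto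
      moreover have "indicat_real {-1..1} \<xi> = 1" "indicat_real {-1<..<1} \<xi> = 1"
        using True by (auto simp: indicator_def)
      ultimately show ?thesis
        by (simp only: mult_1)
    next
      case False
      with elim have \<xi>: "\<bar>\<xi>\<bar> > 1" by (auto simp: abs_if split: if_splits)
      have "cmod (p \<xi>) \<le> cmod (q \<xi>) * (1 / \<bar>\<xi>\<bar>)"
        using pq[OF \<xi>] by simp
      also have "\<dots> \<le> (cmod (q \<xi>))\<^sup>2 + (1 / \<bar>\<xi>\<bar>)\<^sup>2"
      proof -
        have "0 \<le> cmod (q \<xi>) * (1 / \<bar>\<xi>\<bar>)" by simp
        then show ?thesis
          using sum_squares_bound[of "cmod (q \<xi>)" "1 / \<bar>\<xi>\<bar>"] by linarith
      qed
      also have "(1 / \<bar>\<xi>\<bar>)\<^sup>2 \<le> 2 * (1 / (1 + \<xi>\<^sup>2))"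
      proof -
        have "1 \<le> \<xi>\<^sup>2" using \<xi> one_le_power[of "\<bar>\<xi>\<bar>" 2] by simp
        moreover from this have "0 < \<xi>\<^sup>2" by linarith
        ultimately show ?thesis by (simp add: power_divide field_simps)
      qed
      finally show ?thesis
        using \<xi> by (auto simp: indicator_def)
    qed
    then show ?case by (simp add: abs_le_iff)
  qed
qed measurable


subsection \<open>Dispersive decay\<close>

theorem theorem1:
  fixes u0 :: "real \<Rightarrow> complex"
  assumes "u0 square_integrable_on UNIV"
    and "(\<lambda>x. of_real x * u0 x) square_integrable_on UNIV"
    and "(\<lambda>\<xi>. L2_fourier u0 \<xi> / of_real (\<xi>\<^sup>2)) square_integrable_on {-1<..<1}"
    and "(\<lambda>\<xi>. weak_deriv (L2_fourier u0) \<xi> / of_real \<xi>) square_integrable_on {-1<..<1}"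
  shows "\<exists>C>0. \<forall>t x :: real. t \<noteq> 0 \<longrightarrow>
           (truncated_schroedinger u0 t x \<longlongrightarrow> free_schroedinger u0 t x) at_top \<and>
           cmod (free_schroedinger u0 t x) \<le> C * (1 + \<bar>x\<bar>) * inverse \<bar>t\<bar>"
proof -
  have u0m: "u0 \<in> borel_measurable lebesgue"
    using assms(1) by (simp add: square_integrable_on_UNIV_iff)
  obtain v where v [measurable]: "v \<in> borel_measurable lborel" and uv: "AE x in lebesgue. u0 x = v x"
    using lebesgue_borel_version[OF u0m] .
  have v2: "integrable lborel (\<lambda>x. (cmod (v x))\<^sup>2)"
    using square_integrable_on_version[OF assms(1) v _ uv] by simp
  have "AE x in lebesgue. of_real x * u0 x = of_real x * v x"
    using uv by eventually_elim simp
  then have xv2: "integrable lborel (\<lambda>x. (cmod (of_real x * v x))\<^sup>2)"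
    using square_integrable_on_version[OF assms(2), of "\<lambda>x. of_real x * v x"] by simp
  have v1: "integrable lborel v"
    by (rule integrable_weighted_L2[OF v v2 xv2])
  define F where "F = fourier v"
  have contF: "continuous_on UNIV F"
    unfolding F_def by (rule continuous_fourier[OF v1])
  have F [measurable]: "F \<in> borel_measurable lborel"
    unfolding F_def by (rule measurable_fourier[OF v1])
  have F2: "integrable lborel (\<lambda>\<xi>. (cmod (F \<xi>))\<^sup>2)"
    unfolding F_def by (rule fourier_square_integrable[OF v1 v2])
  obtain G where G [measurable]: "G \<in> borel_measurable lborel" and G2: "integrable lborel (\<lambda>\<xi>. (cmod (G \<xi>))\<^sup>2)"
    and FG: "\<And>a b. a \<le> b \<Longrightarrow> F b - F a = (LINT \<xi>:{a..b}|lborel. G \<xi>)"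
    using fourier_indefinite_integral[OF v v2 xv2] unfolding F_def by blast
  have Gi: "set_integrable lborel {a..b} G" for a b
    by (rule square_integrable_imp_set_integrable_Icc[OF G G2])

  define w where "w = L2_fourier u0"
  have uF: "u0 has_L2_fourier_transform F"
    unfolding F_def by (rule has_L2_fourier_transform_fourier[OF u0m v uv v1 v2])
  then have uw: "u0 has_L2_fourier_transform w"
    unfolding w_def L2_fourier_def by (rule someI[of "\<lambda>w. u0 has_L2_fourier_transform w"])
  then have wm: "w \<in> borel_measurable lebesgue"
    by (simp add: has_L2_fourier_transform_def square_integrable_on_UNIV_iff)
  have wF: "AE \<xi> in lebesgue. w \<xi> = F \<xi>"
  proof (rule has_L2_fourier_transform_unique[OF uF uw])
    show "truncated_fourier R u0 \<in> borel_measurable lebesgue" for R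
      unfolding truncated_fourier_eq[OF u0m v uv]
      by (intro measurable_completion measurable_fourier integrable_mult_indicator v1) simp
  qed
  define g where "g = weak_deriv w"
  have wG: "w has_weak_derivative G"
    by (rule weak_derivative_of_indefinite_integral[OF wm wF contF G Gi FG])
  then have wg: "w has_weak_derivative g"
    unfolding g_def weak_deriv_def by (rule someI[of "\<lambda>g. w has_weak_derivative g"])
  then have "locally_integrable g"
    by (simp add: has_weak_derivative_def)
  then obtain g' where g' [measurable]: "g' \<in> borel_measurable lborel" and gm: "g \<in> borel_measurable lebesgue"
    and gg': "AE x in lebesgue. g x = g' x" and g'i: "\<And>a b. set_integrable lborel {a..b} g'"
    using locally_integrable_borel_version by blast

  \<comment> \<open>The weighted hypothesis controls the chosen derivative on
    \<open>{-1<..<1}\<close>, and \<open>G\<close> is square integrable on the whole line. Each is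
    used on the region where the quotient by \<open>\<xi>\<close> can be estimated.\<close>
  define h where "h \<xi> = (if \<xi> \<in> {-1..1} then g' \<xi> else G \<xi>)" for \<xi>
  have hi: "set_integrable lborel {a..b} h" and hG: "(LINT \<xi>:{a..b}|lborel. h \<xi>) = (LINT \<xi>:{a..b}|lborel. G \<xi>)" for a b
    using patched_indefinite_integral[OF g'i Gi weak_derivative_integral_unique[OF wg wG gm g' gg' g'i G Gi] h_def] by auto
  have [measurable]: "h \<in> borel_measurable lborel"
    unfolding h_def by measurable
  have near_F: "integrable lborel (\<lambda>\<xi>. indicator {-1<..<1} \<xi> * (cmod (F \<xi> / of_real (\<xi>\<^sup>2)))\<^sup>2)"
  proof (rule square_integrable_on_version[OF assms(3)])
    show "AE \<xi> in lebesgue. L2_fourier u0 \<xi> / of_real (\<xi>\<^sup>2) = F \<xi> / of_real (\<xi>\<^sup>2)"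
      using wF by eventually_elim (simp add: w_def)
  qed measurable
  have "integrable lborel (\<lambda>\<xi>. indicator {-1<..<1} \<xi> * (cmod (g' \<xi> / of_real \<xi>))\<^sup>2)"
  proof (rule square_integrable_on_version[OF assms(4)])
    show "AE \<xi> in lebesgue. weak_deriv (L2_fourier u0) \<xi> / of_real \<xi> = g' \<xi> / of_real \<xi>"
      using gg' by eventually_elim (simp add: g_def w_def)
  qed measurable
  moreover have "indicat_real {-1<..<1} \<xi> * (cmod (g' \<xi> / of_real \<xi>))\<^sup>2 =
      indicat_real {-1<..<1} \<xi> * (cmod (h \<xi> / of_real \<xi>))\<^sup>2" for \<xi>
    by (auto simp: h_def indicator_def)
  ultimately have near_h: "integrable lborel (\<lambda>\<xi>. indicator {-1<..<1} \<xi> * (cmod (h \<xi> / of_real \<xi>))\<^sup>2)"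
    by simp
  \<comment> \<open>For \<open>\<bar>\<xi>\<bar> < 1\<close> the quotient by \<open>\<xi>\<close> is
    dominated by the quotient by \<open>\<xi>\<^sup>2\<close>, so the first hypothesis near the
    origin serves both. At 0 both quotients are 0 by convention.\<close>
  have near_F1: "integrable lborel (\<lambda>\<xi>. indicator {-1<..<1} \<xi> * (cmod (F \<xi> / of_real \<xi>))\<^sup>2)"
  proof (rule Bochner_Integration.integrable_bound[OF near_F])
    have "cmod (F \<xi> / of_real \<xi>) \<le> cmod (F \<xi> / of_real (\<xi>\<^sup>2))" if "\<bar>\<xi>\<bar> < 1" for \<xi>
    proof (cases "\<xi> = 0")
      case False
      then have "\<xi>\<^sup>2 \<le> \<bar>\<xi>\<bar>"
        using that mult_left_mono[of "\<bar>\<xi>\<bar>" 1 "\<bar>\<xi>\<bar>"] by (simp add: power2_eq_square)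
      then show ?thesis
        using False by (auto simp: norm_divide norm_power intro!: frac_le)
    qed simp
    then show "AE \<xi> in lborel. norm (indicat_real {-1<..<1} \<xi> * (cmod (F \<xi> / of_real \<xi>))\<^sup>2)
        \<le> norm (indicat_real {-1<..<1} \<xi> * (cmod (F \<xi> / of_real (\<xi>\<^sup>2)))\<^sup>2)"
      by (intro AE_I2) (auto simp: indicator_def abs_less_iff simp del: of_real_power intro!: power_mono)
  qed measurable
  have iF1: "integrable lborel (\<lambda>\<xi>. F \<xi> / of_real \<xi>)"
    by (rule integrable_from_L2_pieces[OF _ near_F1 F2]) (measurable, simp add: norm_divide)
  have iF2: "integrable lborel (\<lambda>\<xi>. F \<xi> / of_real (\<xi>\<^sup>2))"
  proof (rule integrable_from_L2_pieces[OF _ near_F F2])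
    show "cmod (F \<xi> / of_real (\<xi>\<^sup>2)) \<le> cmod (F \<xi>) / \<bar>\<xi>\<bar>" if "\<bar>\<xi>\<bar> > 1" for \<xi>
    proof -
      have "\<bar>\<xi>\<bar> \<le> \<xi>\<^sup>2"
        using that mult_left_mono[of 1 "\<bar>\<xi>\<bar>" "\<bar>\<xi>\<bar>"] by (simp add: power2_eq_square)
      then show ?thesis
        using that by (auto simp: norm_divide norm_power intro!: frac_le)
    qed
  qed measurable
  have ih1: "integrable lborel (\<lambda>\<xi>. h \<xi> / of_real \<xi>)"
    by (rule integrable_from_L2_pieces[OF _ near_h G2]) (measurable, auto simp: norm_divide h_def)

  define c where "c = (2 * pi) powr (-1/2)"
  have c: "c > 0" by (simp add: c_def)
  define S where "S = (\<integral>\<xi>. cmod (F \<xi> / of_real \<xi>) \<partial>lborel) + (\<integral>\<xi>. cmod (F \<xi> / of_real (\<xi>\<^sup>2)) \<partial>lborel)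
      + (\<integral>\<xi>. cmod (h \<xi> / of_real \<xi>) \<partial>lborel)"
  have "S \<ge> 0"
    unfolding S_def by (intro add_nonneg_nonneg Bochner_Integration.integral_nonneg) simp_all
  have Fb: "cmod (F \<xi>) \<le> (2 * pi) powr (-1/2) * (\<integral>x. cmod (v x) \<partial>lborel)" for \<xi>
    unfolding F_def by (rule fourier_bounded)
  have Fh: "F b - F a = (LINT \<xi>:{a..b}|lborel. h \<xi>)" if "a \<le> b" for a b
    using FG[OF that] hG by simp
  have trunc: "truncated_schroedinger u0 t x R = of_real c * (LINT \<xi>:{-R..R}|lborel. phase t x \<xi> * F \<xi>)" for t x R
  proof -
    have [measurable]: "phase t x \<in> borel_measurable lborel"
      using borel_measurable_continuous_onI[OF continuous_phase] by simp
    have "(LINT \<xi>|lebesgue. indicat_real {-R..R} \<xi> *\<^sub>R (phase t x \<xi> * w \<xi>)) =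
        (LINT \<xi>|lborel. indicat_real {-R..R} \<xi> *\<^sub>R (phase t x \<xi> * F \<xi>))"
    proof (rule integral_lebesgue_cong)
      have "(\<lambda>\<xi>. indicat_real {-R..R} \<xi> *\<^sub>R phase t x \<xi>) \<in> borel_measurable lebesgue"
        by (rule measurable_completion) measurable
      then have "(\<lambda>\<xi>. indicat_real {-R..R} \<xi> *\<^sub>R phase t x \<xi> * w \<xi>) \<in> borel_measurable lebesgue"
        using wm by (rule borel_measurable_times)
      then show "(\<lambda>\<xi>. indicat_real {-R..R} \<xi> *\<^sub>R (phase t x \<xi> * w \<xi>)) \<in> borel_measurable lebesgue"
        by simp
      show "AE \<xi> in lebesgue. indicat_real {-R..R} \<xi> *\<^sub>R (phase t x \<xi> * w \<xi>) =
          indicat_real {-R..R} \<xi> *\<^sub>R (phase t x \<xi> * F \<xi>)"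
        using wF by eventually_elim simp
    qed measurable
    then show ?thesis
      unfolding truncated_schroedinger_def set_lebesgue_integral_def w_def phase_def c_def by simp
  qed
  \<comment> \<open>\<open>S\<close> collects three integrals free of \<open>t\<close> and
    \<open>x\<close>. Adding 1 makes the constant positive even when \<open>S\<close> is 0, as for
    vanishing initial data.\<close>
  have main: "(truncated_schroedinger u0 t x \<longlongrightarrow> free_schroedinger u0 t x) at_top \<and>
      cmod (free_schroedinger u0 t x) \<le> (c * S + 1) * (1 + \<bar>x\<bar>) * inverse \<bar>t\<bar>" if t: "t \<noteq> 0" for t x
  proof -
    \<comment> \<open>\<open>free_schroedinger\<close> is given by \<open>Lim\<close>, so
      convergence to an explicit value has to be proved before anything can be said about
      it.\<close>
    define L where "L = of_real c * ((\<integral>\<xi>. phase_remainder F h t x \<xi> \<partial>lborel) / (\<i> * of_real t))"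
    have lim: "(truncated_schroedinger u0 t x \<longlongrightarrow> L) at_top"
      unfolding trunc[abs_def] L_def
      by (intro tendsto_mult tendsto_const phase_integral_limit[OF contF Fb hi Fh iF1 iF2 ih1 t])
    then have L: "free_schroedinger u0 t x = L"
      using t by (simp add: free_schroedinger_def tendsto_Lim)
    have "cmod L = c * (cmod (\<integral>\<xi>. phase_remainder F h t x \<xi> \<partial>lborel) * inverse \<bar>t\<bar>)"
      using c by (simp add: L_def norm_mult norm_divide norm_inverse divide_inverse)
    also have "\<dots> \<le> c * (S * (1 + \<bar>x\<bar>) * inverse \<bar>t\<bar>)"
      using c remainder_bound[OF contF Fb hi Fh iF1 iF2 ih1, of t x]
      by (intro mult_left_mono mult_right_mono) (auto simp: S_def)
    also have "\<dots> \<le> (c * S + 1) * (1 + \<bar>x\<bar>) * inverse \<bar>t\<bar>"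
      by (simp add: algebra_simps)
    finally show ?thesis
      using lim L by simp
  qed
  show ?thesis
    using c \<open>S \<ge> 0\<close> main by (intro exI[of _ "c * S + 1"]) (auto intro!: add_nonneg_pos)
qed

end
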